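(* For every integer $q\geq2$, the group $\mathrm{QI}(T_q)$ of quasi-isometries and the group $\mathrm{AI}(T_q)$ of almost-isometries of the regular tree $T_q$ are $5$-uniformly simple.
   Context: $T_q$ is the regular tree all of whose vertices have degree $q+1$, with the path metric on its vertices. For $\lambda\geq1$ and $K\geq0$, a $(\lambda,K)$-quasi-isometry between metric spaces $(X,d_X)$ and $(Y,d_Y)$ is a map $f\colon X\to Y$ such that $\lambda^{-1}d_X(x,x')-K\leq d_Y(f(x),f(x'))\leq\lambda d_X(x,x')+K$ for all $x,x'\in X$ and for all $y\in Y$ there exists $x\in X$ with $d_Y(y,f(x))\leq K$. A $K$-almost-isometry is a $(1,K)$-quasi-isometry. A map is a quasi-isometry (respectively almost-isometry) if it is a $(\lambda,K)$-quasi-isometry for some $\lambda,K$ (respectively a $K$-almost-isometry for some $K$). Two quasi-isometries $X\to Y$ are equivalent if they are at bounded distance in the supremum metric. $\mathrm{QI}(X)$ (respectively $\mathrm{AI}(X)$) is the group of all quasi-isometries (respectively almost-isometries) from $X$ to itself, up to equivalence, under composition. A group $G$ is called $N$-uniformly simple if for every nontrivial $f\in G$ and every nontrivial conjugacy class $C\subset G$, the element $f$ is a product of at most $N$ elements of $C^{\pm1}=C\cup C^{-1}$. *)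

theory Defs
  imports Complex_Main "HOL-Algebra.Group"
begin

section \<open>Regular trees and their path metric\<close>

definition simple_graph :: "'v set \<Rightarrow> ('v \<Rightarrow> 'v \<Rightarrow> bool) \<Rightarrow> bool" where
  "simple_graph V E \<longleftrightarrow> (\<forall>u v. E u v \<longrightarrow> u \<in> V \<and> v \<in> V) \<and> symp E \<and> irreflp E"

text \<open>Walks are given by their nonempty list of vertices; a walk has one edge less than vertices.\<close>

definition is_walk :: "'v set \<Rightarrow> ('v \<Rightarrow> 'v \<Rightarrow> bool) \<Rightarrow> 'v \<Rightarrow> 'v \<Rightarrow> 'v list \<Rightarrow> bool" where
  "is_walk V E u v p \<longleftrightarrow>
     p \<noteq> [] \<and> set p \<subseteq> V \<and> successively E p \<and> hd p = u \<and> last p = v"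

definition connected_graph :: "'v set \<Rightarrow> ('v \<Rightarrow> 'v \<Rightarrow> bool) \<Rightarrow> bool" where
  "connected_graph V E \<longleftrightarrow> V \<noteq> {} \<and> (\<forall>u\<in>V. \<forall>v\<in>V. \<exists>p. is_walk V E u v p)"

definition is_cycle :: "'v set \<Rightarrow> ('v \<Rightarrow> 'v \<Rightarrow> bool) \<Rightarrow> 'v list \<Rightarrow> bool" where
  "is_cycle V E p \<longleftrightarrow>
     3 \<le> length p \<and> distinct p \<and> set p \<subseteq> V \<and> successively E p \<and> E (last p) (hd p)"

definition is_tree :: "'v set \<Rightarrow> ('v \<Rightarrow> 'v \<Rightarrow> bool) \<Rightarrow> bool" where
  "is_tree V E \<longleftrightarrow> simple_graph V E \<and> connected_graph V E \<and> (\<nexists>p. is_cycle V E p)"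

text \<open>
  A regular tree in which all degrees are \<open>q + 1\<close>; it is unique up to isomorphism.  Since
  \<open>q + 1\<close> is positive, the cardinality condition forces all neighbourhoods to be finite.
\<close>

definition regular_tree :: "nat \<Rightarrow> 'v set \<Rightarrow> ('v \<Rightarrow> 'v \<Rightarrow> bool) \<Rightarrow> bool" where
  "regular_tree q V E \<longleftrightarrow> is_tree V E \<and> (\<forall>v\<in>V. card {w \<in> V. E v w} = q + 1)"

definition path_dist :: "'v set \<Rightarrow> ('v \<Rightarrow> 'v \<Rightarrow> bool) \<Rightarrow> 'v \<Rightarrow> 'v \<Rightarrow> real" where
  "path_dist V E u v = real (LEAST n. \<exists>p. is_walk V E u v p \<and> length p = Suc n)"


section \<open>Quasi-isometries and almost-isometries\<close>

text \<open>
  A metric space is given by its carrier and its distance function.  Maps are total functions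
  sending carrier to carrier; their values outside the carrier are irrelevant, and any two maps
  that agree on the carrier become identified in the quotient groups below.
\<close>

definition is_qi_with ::
  "real \<Rightarrow> real \<Rightarrow> 'a set \<Rightarrow> ('a \<Rightarrow> 'a \<Rightarrow> real) \<Rightarrow> 'b set \<Rightarrow> ('b \<Rightarrow> 'b \<Rightarrow> real) \<Rightarrow> ('a \<Rightarrow> 'b) \<Rightarrow> bool"
  where
  "is_qi_with l K X dX Y dY f \<longleftrightarrow>
     f \<in> X \<rightarrow> Y \<and>
     (\<forall>x\<in>X. \<forall>x'\<in>X. inverse l * dX x x' - K \<le> dY (f x) (f x') \<and>
                     dY (f x) (f x') \<le> l * dX x x' + K) \<and>
     (\<forall>y\<in>Y. \<exists>x\<in>X. dY y (f x) \<le> K)"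

definition quasi_isometries :: "'a set \<Rightarrow> ('a \<Rightarrow> 'a \<Rightarrow> real) \<Rightarrow> ('a \<Rightarrow> 'a) set" where
  "quasi_isometries X d = {f. \<exists>l\<ge>1. \<exists>K\<ge>0. is_qi_with l K X d X d f}"

definition almost_isometries :: "'a set \<Rightarrow> ('a \<Rightarrow> 'a \<Rightarrow> real) \<Rightarrow> ('a \<Rightarrow> 'a) set" where
  "almost_isometries X d = {f. \<exists>K\<ge>0. is_qi_with 1 K X d X d f}"

definition bounded_distance_rel ::
  "'a set \<Rightarrow> ('a \<Rightarrow> 'a \<Rightarrow> real) \<Rightarrow> ('a \<Rightarrow> 'a) set \<Rightarrow> (('a \<Rightarrow> 'a) \<times> ('a \<Rightarrow> 'a)) set" where
  "bounded_distance_rel X d S =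
     {(f, g). f \<in> S \<and> g \<in> S \<and> (\<exists>B. \<forall>x\<in>X. d (f x) (g x) \<le> B)}"

definition maps_mod_bounded ::
  "'a set \<Rightarrow> ('a \<Rightarrow> 'a \<Rightarrow> real) \<Rightarrow> ('a \<Rightarrow> 'a) set \<Rightarrow> ('a \<Rightarrow> 'a) set monoid" where
  "maps_mod_bounded X d S =
     \<lparr>carrier = S // bounded_distance_rel X d S,
      mult = (\<lambda>A B. \<Union>f\<in>A. \<Union>g\<in>B. bounded_distance_rel X d S `` {f \<circ> g}),
      one = bounded_distance_rel X d S `` {id}\<rparr>"

definition QI :: "'a set \<Rightarrow> ('a \<Rightarrow> 'a \<Rightarrow> real) \<Rightarrow> ('a \<Rightarrow> 'a) set monoid" where
  "QI X d = maps_mod_bounded X d (quasi_isometries X d)"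

definition AI :: "'a set \<Rightarrow> ('a \<Rightarrow> 'a \<Rightarrow> real) \<Rightarrow> ('a \<Rightarrow> 'a) set monoid" where
  "AI X d = maps_mod_bounded X d (almost_isometries X d)"


section \<open>Uniform simplicity\<close>

definition conjugacy_classes :: "('g, 'm) monoid_scheme \<Rightarrow> 'g set set" where
  "conjugacy_classes G =
     {{x \<otimes>\<^bsub>G\<^esub> c \<otimes>\<^bsub>G\<^esub> inv\<^bsub>G\<^esub> x | x. x \<in> carrier G} | c. c \<in> carrier G}"

definition uniformly_simple :: "nat \<Rightarrow> ('g, 'm) monoid_scheme \<Rightarrow> bool" where
  "uniformly_simple N G \<longleftrightarrow>
     group G \<and>
     (\<forall>f \<in> carrier G - {\<one>\<^bsub>G\<^esub>}. \<forall>C \<in> conjugacy_classes G - {{\<one>\<^bsub>G\<^esub>}}.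
        \<exists>cs. length cs \<le> N \<and> set cs \<subseteq> C \<union> m_inv G ` C \<and>
             f = foldr (mult G) cs \<one>\<^bsub>G\<^esub>)"

end

theory Submission
  imports Defs "HOL-Library.Sublist"
begin

text \<open>
  Up to bounded distance, \<open>T\<^sub>q\<close> is the rooted \<open>q\<close>-ary tree \<open>X\<close> of words, and both groups are groups of
  coarse self-equivalences of \<open>X\<close>, with multiplicative constants in \<open>L = {1..}\<close> and \<open>L = {1}\<close>
  respectively. A nontrivial element moves some branch \<open>a X\<close> off itself. All clopen proper parts of
  the boundary are equivalent by a Hilbert hotel argument, so a nontrivial class \<open>f\<close> can be conjugated
  such that its restriction to a branch is prescribed. Hence \<open>f\<close> and \<open>c\<close> have
  conjugates that agree on a branch which both carry onto the complement of a single branch \<open>B\<close>, and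
  their quotient \<open>g\<close> is supported in \<open>B\<close>. For such a \<open>g\<close>, let \<open>s\<close>
  move \<open>B\<close> to infinitely many disjoint branches \<open>s\<^sup>n B\<close> and let \<open>F\<close> act as \<open>s\<^sup>n g s\<^sup>-\<^sup>n\<close> on \<open>s\<^sup>n B\<close> for \<open>n \<ge> 0\<close>.
  Then \<open>g = [F, s]\<close>, and if a conjugate \<open>c\<close> moves the support of \<open>F\<close> to a set where \<open>s\<close> is trivial, then
  \<open>g = [[F, c], s]\<close> is a product of four conjugates of \<open>c\<close> and its inverse.
\<close>

section \<open>Coarse maps of a metric space modulo bounded distance\<close>

text \<open>Maps matter only up to bounded distance: inverses are coarse, and the image of a branch
  need not be a union of branches. Disjointness of sets is therefore replaced by a bound on
  \<open>lcp\<close>, the Gromov product at the root, which is disjointness on the boundary. Maps on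
  pieces separated in this sense can be glued (\<open>qie_glue\<close>), since distances across them
  are sums of lengths up to a constant. Almost-isometries add a second demand: no construction may
  spoil the multiplicative constant 1. Hence the auxiliary maps move whole branches rigidly by
  bounded amounts. This is possible for infinitely many branches at once, because the distance of
  words in different branches is depth plus depth plus the distance of the branch roots. Larger
  constants come only from the given maps, and \<open>L\<close> is closed under products. The number
  5 is 4 + 1: four factors from the double commutator and one for the conjugate of \<open>c\<close>
  that is divided off from the conjugate of \<open>f\<close>.\<close>

locale scale_set =
  fixes L :: "real set"
  assumes one_in: "1 \<in> L" and ge_one: "l \<in> L \<Longrightarrow> 1 \<le> l"
    and mult_in: "l \<in> L \<Longrightarrow> m \<in> L \<Longrightarrow> l * m \<in> L"

locale coarse_space = scale_set L for L +
  fixes V :: "'a set" and d :: "'a \<Rightarrow> 'a \<Rightarrow> real"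
  assumes d_self: "x \<in> V \<Longrightarrow> d x x = 0"
    and d_sym: "x \<in> V \<Longrightarrow> y \<in> V \<Longrightarrow> d x y = d y x"
    and d_tri: "x \<in> V \<Longrightarrow> y \<in> V \<Longrightarrow> z \<in> V \<Longrightarrow> d x z \<le> d x y + d y z"
begin

text \<open>Density is kept apart in \<open>codense\<close>, so that maps can be assembled from
  embeddings of subsets \<open>P\<close> that need not be dense.\<close>

definition qie :: "'a set \<Rightarrow> ('a \<Rightarrow> 'a) \<Rightarrow> bool" where
  "qie P f \<longleftrightarrow> (\<exists>l\<in>L. \<exists>K\<ge>0. \<forall>x\<in>P. \<forall>y\<in>P.
     inverse l * d x y - K \<le> d (f x) (f y) \<and> d (f x) (f y) \<le> l * d x y + K)"

definition codense :: "'a set \<Rightarrow> ('a \<Rightarrow> 'a) \<Rightarrow> bool" where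
  "codense P f \<longleftrightarrow> (\<exists>K. \<forall>y\<in>V. \<exists>x\<in>P. d y (f x) \<le> K)"

definition near :: "'a set \<Rightarrow> ('a \<Rightarrow> 'a) \<Rightarrow> ('a \<Rightarrow> 'a) \<Rightarrow> bool" where
  "near P f g \<longleftrightarrow> (\<exists>B. \<forall>x\<in>P. d (f x) (g x) \<le> B)"

definition S :: "('a \<Rightarrow> 'a) set" where
  "S = {f. \<exists>l\<in>L. \<exists>K\<ge>0. is_qi_with l K V d V d f}"

lemma S_iff: "f \<in> S \<longleftrightarrow> f \<in> V \<rightarrow> V \<and> qie V f \<and> codense V f"
proof
  assume "f \<in> S"
  then show "f \<in> V \<rightarrow> V \<and> qie V f \<and> codense V f"
    unfolding S_def is_qi_with_def qie_def codense_def by blast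
next
  assume f: "f \<in> V \<rightarrow> V \<and> qie V f \<and> codense V f"
  then obtain l K K' where l: "l \<in> L" and K: "K \<ge> 0"
    and 1: "\<And>x y. x \<in> V \<Longrightarrow> y \<in> V \<Longrightarrow>
       inverse l * d x y - K \<le> d (f x) (f y) \<and> d (f x) (f y) \<le> l * d x y + K"
    and 2: "\<And>y. y \<in> V \<Longrightarrow> \<exists>x\<in>V. d y (f x) \<le> K'"
    unfolding qie_def codense_def by blast
  have "is_qi_with l (max K K') V d V d f"
    unfolding is_qi_with_def
  proof (intro conjI ballI)
    show "f \<in> V \<rightarrow> V" using f by blast
    fix x y assume xy: "x \<in> V" "y \<in> V"
    show "inverse l * d x y - max K K' \<le> d (f x) (f y)" "d (f x) (f y) \<le> l * d x y + max K K'"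
      using 1[OF xy] by linarith+
  next
    fix y assume "y \<in> V"
    then show "\<exists>x\<in>V. d y (f x) \<le> max K K'" using 2[of y] by force
  qed
  then show "f \<in> S" unfolding S_def using l K by (auto intro!: bexI[of _ l] exI[of _ "max K K'"])
qed

lemma S_closed: "f \<in> S \<Longrightarrow> x \<in> V \<Longrightarrow> f x \<in> V"
  by (auto simp: S_iff)

lemma S_qie: "f \<in> S \<Longrightarrow> qie V f"
  by (simp add: S_iff)

lemma qie_cong: "qie P f \<Longrightarrow> (\<And>x. x \<in> P \<Longrightarrow> f x = g x) \<Longrightarrow> qie P g"
  unfolding qie_def by metis

lemma qieI_one:
  assumes "\<And>x y. x \<in> P \<Longrightarrow> y \<in> P \<Longrightarrow> \<bar>d (f x) (f y) - d x y\<bar> \<le> C"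
  shows "qie P f"
  unfolding qie_def
proof (intro bexI[of _ 1] exI[of _ "max C 0"] conjI ballI one_in)
  fix x y assume "x \<in> P" "y \<in> P"
  from assms[OF this]
  show "inverse 1 * d x y - max C 0 \<le> d (f x) (f y)" "d (f x) (f y) \<le> 1 * d x y + max C 0"
    by auto
qed auto

lemma qie_upper:
  assumes "qie P f"
  shows "\<exists>B'. \<forall>x\<in>P. \<forall>y\<in>P. d x y \<le> B \<longrightarrow> d (f x) (f y) \<le> B'"
proof -
  obtain l K where l: "l \<in> L" and
    1: "\<And>x y. x \<in> P \<Longrightarrow> y \<in> P \<Longrightarrow> d (f x) (f y) \<le> l * d x y + K"
    using assms unfolding qie_def by blast
  have "d (f x) (f y) \<le> l * B + K" if "x \<in> P" "y \<in> P" "d x y \<le> B" for x y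
    using 1[of x y] that ge_one[OF l] mult_left_mono[of "d x y" B l] by linarith
  then show ?thesis by blast
qed

lemma qie_lower:
  assumes "qie P f"
  shows "\<exists>B'. \<forall>x\<in>P. \<forall>y\<in>P. d (f x) (f y) \<le> B \<longrightarrow> d x y \<le> B'"
proof -
  obtain l K where l: "l \<in> L" and
    1: "\<And>x y. x \<in> P \<Longrightarrow> y \<in> P \<Longrightarrow> inverse l * d x y - K \<le> d (f x) (f y)"
    using assms unfolding qie_def by blast
  have "d x y \<le> l * (B + K)" if "x \<in> P" "y \<in> P" "d (f x) (f y) \<le> B" for x y
  proof -
    have "inverse l * d x y \<le> B + K" using 1[of x y] that by linarith
    from mult_left_mono[OF this, of l] show ?thesis using ge_one[OF l] by (simp add: field_simps)
  qed
  then show ?thesis by blast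
qed

lemma qie_comp:
  assumes f: "qie P f" and g: "qie Q g" and fP: "\<And>x. x \<in> P \<Longrightarrow> f x \<in> Q"
  shows "qie P (\<lambda>x. g (f x))"
proof -
  obtain l K where l: "l \<in> L" "K \<ge> 0" and
    1: "\<And>x y. x \<in> P \<Longrightarrow> y \<in> P \<Longrightarrow>
       inverse l * d x y - K \<le> d (f x) (f y) \<and> d (f x) (f y) \<le> l * d x y + K"
    using f unfolding qie_def by blast
  obtain m M where m: "m \<in> L" "M \<ge> 0" and
    2: "\<And>x y. x \<in> Q \<Longrightarrow> y \<in> Q \<Longrightarrow>
       inverse m * d x y - M \<le> d (g x) (g y) \<and> d (g x) (g y) \<le> m * d x y + M"
    using g unfolding qie_def by blast
  have m1: "1 \<le> m" using ge_one m by blast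
  have im: "0 \<le> inverse m" "inverse m \<le> 1" using m1 by (auto simp: field_simps)
  show ?thesis unfolding qie_def
  proof (intro bexI[of _ "l * m"] exI[of _ "m * K + M"] conjI ballI)
    show "l * m \<in> L" using l m mult_in by blast
    show "0 \<le> m * K + M" using l m m1 by simp
    fix x y assume xy: "x \<in> P" "y \<in> P"
    note 1 = 1[OF xy] and 2 = 2[OF fP[OF xy(1)] fP[OF xy(2)]]
    have "inverse m * (inverse l * d x y - K) \<le> inverse m * d (f x) (f y)"
      using 1 im by (intro mult_left_mono) auto
    moreover have "inverse m * K \<le> m * K" using im m1 l by (intro mult_right_mono) auto
    ultimately show "inverse (l * m) * d x y - (m * K + M) \<le> d (g (f x)) (g (f y))"
      using 2 by (simp add: algebra_simps)
    have "m * d (f x) (f y) \<le> m * (l * d x y + K)"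
      using 1 m1 by (intro mult_left_mono) auto
    then show "d (g (f x)) (g (f y)) \<le> l * m * d x y + (m * K + M)"
      using 2 by (simp add: algebra_simps)
  qed
qed

lemma d_quad:
  assumes "x \<in> V" "y \<in> V" "x' \<in> V" "y' \<in> V"
  shows "d x y \<le> d x x' + d x' y' + d y y'"
  using d_tri[of x x' y] d_tri[of x' y' y] d_sym[of y y'] assms by simp

lemma qie_near:
  assumes f: "qie P f" and n: "near P f g" and "f \<in> P \<rightarrow> V" "g \<in> P \<rightarrow> V"
  shows "qie P g"
proof -
  obtain l K where l: "l \<in> L" "K \<ge> 0" and
    1: "\<And>x y. x \<in> P \<Longrightarrow> y \<in> P \<Longrightarrow>
       inverse l * d x y - K \<le> d (f x) (f y) \<and> d (f x) (f y) \<le> l * d x y + K"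
    using f unfolding qie_def by blast
  obtain B where B: "\<And>x. x \<in> P \<Longrightarrow> d (f x) (g x) \<le> B" using n unfolding near_def by blast
  show ?thesis unfolding qie_def
  proof (intro bexI[of _ l] exI[of _ "K + 2 * max B 0"] conjI ballI)
    fix x y assume xy: "x \<in> P" "y \<in> P"
    then have V: "f x \<in> V" "f y \<in> V" "g x \<in> V" "g y \<in> V" using assms by auto
    show "inverse l * d x y - (K + 2 * max B 0) \<le> d (g x) (g y)"
         "d (g x) (g y) \<le> l * d x y + (K + 2 * max B 0)"
      using d_quad[of "f x" "f y" "g x" "g y"] d_quad[of "g x" "g y" "f x" "f y"]
        d_sym[of "f x" "g x"] d_sym[of "f y" "g y"] B[OF xy(1)] B[OF xy(2)] 1[OF xy] V
      by (auto simp: max_def)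
  qed (use l in auto)
qed

lemma near_refl: "f \<in> P \<rightarrow> V \<Longrightarrow> near P f f"
  unfolding near_def by (intro exI[of _ 0]) (simp add: d_self Pi_iff)

lemma near_sym:
  assumes "near P f g" "f \<in> P \<rightarrow> V" "g \<in> P \<rightarrow> V"
  shows "near P g f"
  using assms d_sym unfolding near_def Pi_iff by metis

lemma near_trans:
  assumes "near P f g" "near P g h" "f \<in> P \<rightarrow> V" "g \<in> P \<rightarrow> V" "h \<in> P \<rightarrow> V"
  shows "near P f h"
proof -
  obtain B C where B: "\<forall>x\<in>P. d (f x) (g x) \<le> B" and C: "\<forall>x\<in>P. d (g x) (h x) \<le> C"
    using assms unfolding near_def by blast
  have "d (f x) (h x) \<le> B + C" if "x \<in> P" for x
    using d_tri[of "f x" "g x" "h x"] B C assms(3-5) that by force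
  then show ?thesis unfolding near_def by blast
qed

lemma near_comp_left:
  assumes "near P f g" "h \<in> S" "f \<in> P \<rightarrow> V" "g \<in> P \<rightarrow> V"
  shows "near P (\<lambda>x. h (f x)) (\<lambda>x. h (g x))"
proof -
  obtain B where B: "\<forall>x\<in>P. d (f x) (g x) \<le> B" using assms unfolding near_def by blast
  obtain B' where "\<forall>x\<in>V. \<forall>y\<in>V. d x y \<le> B \<longrightarrow> d (h x) (h y) \<le> B'"
    using qie_upper[OF S_qie[OF assms(2)]] by blast
  then show ?thesis unfolding near_def using B assms(3,4) by blast
qed

lemma near_comp_right:
  assumes "near Q f g" "h \<in> P \<rightarrow> Q"
  shows "near P (\<lambda>x. f (h x)) (\<lambda>x. g (h x))"
  using assms unfolding near_def by blast

lemma S_near: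
  assumes f: "f \<in> S" and n: "near V f g" and g: "g \<in> V \<rightarrow> V"
  shows "g \<in> S"
proof -
  have fV: "f \<in> V \<rightarrow> V" and "qie V f" "codense V f" using f by (auto simp: S_iff)
  then have "qie V g" using qie_near n g by blast
  moreover have "codense V g"
  proof -
    obtain B where B: "\<forall>x\<in>V. d (f x) (g x) \<le> B" using n unfolding near_def by blast
    obtain K where K: "\<forall>y\<in>V. \<exists>x\<in>V. d y (f x) \<le> K"
      using \<open>codense V f\<close> unfolding codense_def by blast
    have "\<exists>x\<in>V. d y (g x) \<le> K + B" if y: "y \<in> V" for y
    proof -
      obtain x where x: "x \<in> V" "d y (f x) \<le> K" using K y by blast
      then have "d y (g x) \<le> K + B" using d_tri[of y "f x" "g x"] B y fV g by force
      with x show ?thesis by blast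
    qed
    then show ?thesis unfolding codense_def by blast
  qed
  ultimately show ?thesis using g by (simp add: S_iff)
qed

lemma S_id: "id \<in> S"
  unfolding S_iff
  by (auto intro!: qieI_one[of _ _ 0] simp: codense_def intro: exI[of _ 0] d_self)
     (metis d_self order_refl)

lemma S_comp:
  assumes f: "f \<in> S" and g: "g \<in> S"
  shows "f \<circ> g \<in> S"
proof -
  have fV: "f \<in> V \<rightarrow> V" and qf: "qie V f" and cf: "codense V f" using f by (auto simp: S_iff)
  have gV: "g \<in> V \<rightarrow> V" and qg: "qie V g" and cg: "codense V g" using g by (auto simp: S_iff)
  have "qie V (f \<circ> g)" using qie_comp[OF qg qf] gV by (auto simp: comp_def)
  moreover have "codense V (f \<circ> g)"
  proof -
    obtain K where K: "\<forall>y\<in>V. \<exists>x\<in>V. d y (f x) \<le> K" using cf unfolding codense_def by blast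
    obtain M where M: "\<forall>y\<in>V. \<exists>x\<in>V. d y (g x) \<le> M" using cg unfolding codense_def by blast
    obtain B where B: "\<forall>x\<in>V. \<forall>y\<in>V. d x y \<le> M \<longrightarrow> d (f x) (f y) \<le> B"
      using qie_upper[OF qf] by blast
    have "\<exists>x\<in>V. d y ((f \<circ> g) x) \<le> K + B" if y: "y \<in> V" for y
    proof -
      obtain x where x: "x \<in> V" "d y (f x) \<le> K" using K y by blast
      obtain z where z: "z \<in> V" "d x (g z) \<le> M" using M x by blast
      have "d y (f (g z)) \<le> K + B"
        using d_tri[of y "f x" "f (g z)"] B x z y fV gV by force
      with z show ?thesis by auto
    qed
    then show ?thesis unfolding codense_def by blast
  qed
  ultimately show ?thesis using fV gV by (auto simp: S_iff)
qed

text \<open>Choosing approximate preimages preserves the multiplicative constant of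
  \<open>f\<close>, so the coarse inverse stays in \<open>S\<close> although reciprocals of elements
  of \<open>L\<close> need not lie in \<open>L\<close>.\<close>

lemma S_inverse:
  assumes f: "f \<in> S"
  obtains f' where "f' \<in> S" "near V (f \<circ> f') id" "near V (f' \<circ> f) id"
proof -
  obtain l K where l: "l \<in> L" and K: "K \<ge> 0" and "is_qi_with l K V d V d f"
    using f unfolding S_def by blast
  then have fV: "\<And>x. x \<in> V \<Longrightarrow> f x \<in> V"
    and 1: "\<And>x y. x \<in> V \<Longrightarrow> y \<in> V \<Longrightarrow>
       inverse l * d x y - K \<le> d (f x) (f y) \<and> d (f x) (f y) \<le> l * d x y + K"
    and 2: "\<forall>y\<in>V. \<exists>x\<in>V. d y (f x) \<le> K"
    unfolding is_qi_with_def by auto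
  have l1: "1 \<le> l" using ge_one l by blast
  from 2 obtain f' where f': "\<And>y. y \<in> V \<Longrightarrow> f' y \<in> V" "\<And>y. y \<in> V \<Longrightarrow> d y (f (f' y)) \<le> K"
    by metis
  have A: "near V (f \<circ> f') id"
    unfolding near_def using f' fV d_sym by (intro exI[of _ K]) auto
  have B: "near V (f' \<circ> f) id"
  proof -
    obtain B' where B': "\<forall>x\<in>V. \<forall>y\<in>V. d (f x) (f y) \<le> K \<longrightarrow> d x y \<le> B'"
      using qie_lower[OF S_qie[OF f]] by blast
    have "d ((f' \<circ> f) x) (id x) \<le> B'" if x: "x \<in> V" for x
      using B' f'(2)[OF fV[OF x]] x f'(1) fV d_sym by simp
    then show ?thesis unfolding near_def by blast
  qed
  have q: "qie V f'"
    unfolding qie_def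
  \<comment> \<open>Replacing \<open>y\<close> by \<open>f (f' y)\<close> costs \<open>K\<close> at
    each end, and the estimate for \<open>f\<close> costs another \<open>K\<close>; the factor
    \<open>l\<close> arises when the estimate is solved for the distance of the preimages.\<close>
  proof (intro bexI[of _ l] exI[of _ "3 * l * K"] conjI ballI l)
    show "0 \<le> 3 * l * K" using l1 K by simp
    fix y y' assume y: "y \<in> V" "y' \<in> V"
    note ff = f'[OF y(1)] f'[OF y(2)]
    note 1 = 1[OF ff(1) ff(3)]
    have q1: "d y y' \<le> d (f (f' y)) (f (f' y')) + 2 * K"
      using d_quad[of y y' "f (f' y)" "f (f' y')"] y ff fV by simp
    have q2: "d (f (f' y)) (f (f' y')) \<le> d y y' + 2 * K"
      using d_quad[of "f (f' y)" "f (f' y')" y y'] y ff fV d_sym[of y "f (f' y)"] d_sym[of y' "f (f' y')"] by simp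
    have "d y y' \<le> l * d (f' y) (f' y') + 3 * K" using q1 1 by linarith
    moreover have "inverse l * (l * d (f' y) (f' y') + 3 * K) = d (f' y) (f' y') + 3 * (inverse l * K)"
      using l1 by (simp add: field_simps)
    moreover have "inverse l * K \<le> l * K" using l1 K by (intro mult_right_mono) (auto simp: field_simps intro: order_trans[of 1 l "l*l"])
    ultimately show "inverse l * d y y' - 3 * l * K \<le> d (f' y) (f' y')"
      using mult_left_mono[of "d y y'" "l * d (f' y) (f' y') + 3 * K" "inverse l"] l1 by simp
    have "inverse l * d (f' y) (f' y') \<le> d y y' + 3 * K" using q2 1 by linarith
    then show "d (f' y) (f' y') \<le> l * d y y' + 3 * l * K"
      using l1 by (simp add: field_simps)
  qed
  have "codense V f'"
  proof -
    obtain B' where "\<forall>x\<in>V. d ((f' \<circ> f) x) (id x) \<le> B'" using B unfolding near_def by blast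
    then have "\<exists>x\<in>V. d y (f' x) \<le> B'" if "y \<in> V" for y
      using that fV f'(1) d_sym by (intro bexI[of _ "f y"]) auto
    then show ?thesis unfolding codense_def by blast
  qed
  with q f' have "f' \<in> S" by (auto simp: S_iff)
  with A B that show thesis by blast
qed

section \<open>The group of classes of coarse maps\<close>

definition cl :: "('a \<Rightarrow> 'a) \<Rightarrow> ('a \<Rightarrow> 'a) set" where
  "cl f = bounded_distance_rel V d S `` {f}"

abbreviation "G \<equiv> maps_mod_bounded V d S"

lemma S_Pi: "f \<in> S \<Longrightarrow> f \<in> V \<rightarrow> V"
  by (simp add: S_iff)

lemma rel_iff: "(f, g) \<in> bounded_distance_rel V d S \<longleftrightarrow> f \<in> S \<and> g \<in> S \<and> near V f g"
  by (simp add: bounded_distance_rel_def near_def)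

lemma equiv_rel: "equiv S (bounded_distance_rel V d S)"
proof (rule equivI)
  show "bounded_distance_rel V d S \<subseteq> S \<times> S" by (auto simp: rel_iff)
  show "refl_on S (bounded_distance_rel V d S)"
    by (rule refl_onI, simp add: rel_iff near_refl S_Pi)
  show "sym (bounded_distance_rel V d S)"
    by (rule symI) (metis near_sym S_Pi rel_iff)
  show "trans (bounded_distance_rel V d S)"
    by (rule transI) (metis near_trans S_Pi rel_iff)
qed

lemma cl_eq_iff: "f \<in> S \<Longrightarrow> g \<in> S \<Longrightarrow> cl f = cl g \<longleftrightarrow> near V f g"
  unfolding cl_def using eq_equiv_class_iff[OF equiv_rel, of f g] by (simp add: rel_iff)

lemma carrier_G: "carrier G = cl ` S"
  by (auto simp: maps_mod_bounded_def quotient_def cl_def)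

lemma one_G: "\<one>\<^bsub>G\<^esub> = cl id"
  by (simp add: maps_mod_bounded_def cl_def)

lemma near_comp:
  assumes "f \<in> S" "f' \<in> S" "g \<in> S" "g' \<in> S" "near V f f'" "near V g g'"
  shows "near V (f \<circ> g) (f' \<circ> g')"
proof -
  have "near V (\<lambda>x. f (g x)) (\<lambda>x. f (g' x))"
    by (rule near_comp_left[OF assms(6,1)]) (intro S_Pi assms)+
  moreover have "near V (\<lambda>x. f (g' x)) (\<lambda>x. f' (g' x))"
    by (rule near_comp_right[OF assms(5)]) (intro S_Pi assms)
  ultimately show ?thesis
    using near_trans[of V "f \<circ> g" "\<lambda>x. f (g' x)" "f' \<circ> g'"] assms S_closed
    by (auto simp: comp_def)
qed

lemma mult_G:
  assumes "f \<in> S" "g \<in> S"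
  shows "cl f \<otimes>\<^bsub>G\<^esub> cl g = cl (f \<circ> g)"
proof -
  have "cl (f' \<circ> g') = cl (f \<circ> g)" if "f' \<in> cl f" "g' \<in> cl g" for f' g'
  proof -
    have "f' \<in> S" "g' \<in> S" "near V f f'" "near V g g'"
      using that by (auto simp: cl_def rel_iff)
    then show ?thesis using assms cl_eq_iff near_comp S_comp by metis
  qed
  moreover have "f \<in> cl f" "g \<in> cl g"
    unfolding cl_def by (intro equiv_class_self[OF equiv_rel] assms)+
  ultimately have "(\<Union>f'\<in>cl f. \<Union>g'\<in>cl g. cl (f' \<circ> g')) = cl (f \<circ> g)" by blast
  then show ?thesis by (simp add: maps_mod_bounded_def cl_def[symmetric])
qed

lemma group_G: "group G"
proof (rule groupI)
  fix x y assume "x \<in> carrier G" "y \<in> carrier G"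
  then show "x \<otimes>\<^bsub>G\<^esub> y \<in> carrier G" by (auto simp: carrier_G mult_G S_comp)
next
  show "\<one>\<^bsub>G\<^esub> \<in> carrier G" by (auto simp: carrier_G one_G S_id)
next
  fix x y z assume "x \<in> carrier G" "y \<in> carrier G" "z \<in> carrier G"
  then show "x \<otimes>\<^bsub>G\<^esub> y \<otimes>\<^bsub>G\<^esub> z = x \<otimes>\<^bsub>G\<^esub> (y \<otimes>\<^bsub>G\<^esub> z)"
    by (auto simp: carrier_G mult_G S_comp comp_assoc)
next
  fix x assume "x \<in> carrier G"
  then show "\<one>\<^bsub>G\<^esub> \<otimes>\<^bsub>G\<^esub> x = x" by (auto simp: carrier_G one_G mult_G S_id)
next
  fix x assume "x \<in> carrier G"
  then obtain f where f: "f \<in> S" "x = cl f" by (auto simp: carrier_G)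
  obtain f' where f': "f' \<in> S" "near V (f' \<circ> f) id" using S_inverse[OF f(1)] by blast
  then have "cl f' \<otimes>\<^bsub>G\<^esub> x = \<one>\<^bsub>G\<^esub>"
    using f by (simp add: mult_G one_G cl_eq_iff S_comp S_id)
  then show "\<exists>y\<in>carrier G. y \<otimes>\<^bsub>G\<^esub> x = \<one>\<^bsub>G\<^esub>" using f' by (auto simp: carrier_G)
qed

end

section \<open>The tree of words\<close>

declare in_lists_conv_set [simp del] in_listsD [rule del] in_listsI [rule del]

fun lcp :: "'a list \<Rightarrow> 'a list \<Rightarrow> nat" where
  "lcp (x # xs) (y # ys) = (if x = y then Suc (lcp xs ys) else 0)"
| "lcp [] ys = 0"
| "lcp xs [] = 0"

text \<open>Words are the vertices of a tree rooted at the empty word: \<open>lcp\<close> is the Gromov product at the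
  root and \<open>ld\<close> the path metric.\<close>

definition ld :: "'a list \<Rightarrow> 'a list \<Rightarrow> real" where
  "ld x y = real (length x) + real (length y) - 2 * real (lcp x y)"

lemma lcp_Nil [simp]: "lcp xs [] = 0" "lcp [] xs = 0"
  by (cases xs; simp)+

lemma lcp_commute: "lcp x y = lcp y x"
  by (induction x y rule: lcp.induct) auto

lemma lcp_le_left: "lcp x y \<le> length x"
  by (induction x y rule: lcp.induct) auto

lemma lcp_le_right: "lcp x y \<le> length y"
  by (induction x y rule: lcp.induct) auto

lemma lcp_self [simp]: "lcp x x = length x"
  by (induction x) auto

lemma lcp_append [simp]: "lcp (b @ x) (b @ y) = length b + lcp x y"
  by (induction b) auto

lemma lcp_append_left [simp]: "lcp (b @ x) b = length b" "lcp b (b @ x) = length b"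
  using lcp_append[of b x "[]"] lcp_append[of b "[]" x] by auto

lemma lcp_ultra: "min (lcp x y) (lcp y z) \<le> lcp x z"
proof (induction x y arbitrary: z rule: lcp.induct)
  case (1 x xs y ys)
  then show ?case by (cases z) auto
qed auto

lemma lcp_append_nonprefix: "\<not> prefix b y \<Longrightarrow> lcp (b @ x) y = lcp b y"
proof (induction b arbitrary: y)
  case (Cons c b)
  then show ?case by (cases y) auto
qed auto

lemma lcp_less_nonprefix: "\<not> prefix b y \<Longrightarrow> lcp b y < length b"
proof (induction b arbitrary: y)
  case (Cons c b)
  then show ?case by (cases y) auto
qed auto

lemma lcp_eq_length_iff: "lcp b y = length b \<longleftrightarrow> prefix b y"
  by (metis lcp_less_nonprefix less_irrefl prefix_def lcp_append_left(2))

lemma lcp_take: "n \<le> length x \<Longrightarrow> lcp (take n x) y = min n (lcp x y)"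
proof (induction x arbitrary: n y)
  case (Cons a x)
  then show ?case by (cases n; cases y) auto
qed auto

lemma ld_sym: "ld x y = ld y x"
  by (simp add: ld_def lcp_commute)

lemma ld_self [simp]: "ld x x = 0"
  by (simp add: ld_def)

lemma ld_nonneg [simp]: "0 \<le> ld x y"
  using lcp_le_left[of x y] lcp_le_right[of x y] by (simp add: ld_def)

lemma ld_Nil [simp]: "ld x [] = length x" "ld [] x = length x"
  by (simp_all add: ld_def)

lemma ld_tri: "ld x z \<le> ld x y + ld y z"
  using lcp_ultra[of x y z] lcp_le_right[of x y] lcp_le_left[of y z]
  by (simp add: ld_def min_def split: if_splits)

lemma ld_append [simp]: "ld (b @ x) (b @ y) = ld x y"
  by (simp add: ld_def)

lemma ld_Cons [simp]: "ld (a # x) (a # y) = ld x y"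
  using ld_append[of "[a]" x y] by simp

lemma ld_append_left [simp]: "ld (b @ x) b = length x" "ld b (b @ x) = length x"
  by (simp_all add: ld_def)

text \<open>A branch hangs on the rest of the tree by its root \<open>b\<close> alone, so every path
  leaving it passes through \<open>b\<close>.\<close>

lemma ld_gate: "\<not> prefix b y \<Longrightarrow> ld (b @ x) y = length x + ld b y"
  by (simp add: ld_def lcp_append_nonprefix)

lemma ld_ge_length: "\<bar>real (length x) - real (length y)\<bar> \<le> ld x y"
  using lcp_le_left[of x y] lcp_le_right[of x y] by (simp add: ld_def)

lemma lcp_le_add_ld: "real (lcp x z) \<le> real (lcp x y) + ld y z"
  using lcp_ultra[of x z y] lcp_le_right[of x z] lcp_le_right[of z y] lcp_commute[of y z]
    lcp_le_left[of z y]
  by (simp add: ld_def min_def split: if_splits)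

text \<open>The four-point form of 0-hyperbolicity, a consequence of the ultrametric inequality for
  Gromov products.\<close>

lemma ld_four: "ld x y + ld z w \<le> max (ld x z + ld y w) (ld x w + ld y z)"
proof -
  have "min (lcp x z + lcp y w) (lcp x w + lcp y z) \<le> lcp x y + lcp z w"
    using lcp_ultra[of x z y] lcp_ultra[of x w y] lcp_ultra[of z x w] lcp_ultra[of z y w]
      lcp_commute[of z x] lcp_commute[of z y] lcp_commute[of w y]
    unfolding min_le_iff_disj by linarith
  then show ?thesis by (auto simp: ld_def min_le_iff_disj le_max_iff_disj)
qed

lemma take_in_lists: "x \<in> lists A \<Longrightarrow> take n x \<in> lists A"
  by (metis append_in_lists_conv append_take_drop_id)

section \<open>Geodesics, medians and coarse images of geodesics\<close>

definition btw :: "'a list \<Rightarrow> 'a list \<Rightarrow> 'a list \<Rightarrow> bool" where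
  "btw x z y \<longleftrightarrow> ld x z + ld z y = ld x y"

lemma btw_refl [simp]: "btw x x y" "btw x y y"
  by (simp_all add: btw_def)

lemma btw_sym: "btw x z y \<longleftrightarrow> btw y z x"
  by (auto simp: btw_def ld_sym)

lemma btw_lcp_le: "btw x z y \<Longrightarrow> lcp x y \<le> length z"
  using lcp_le_left[of z y] lcp_le_right[of x z] by (simp add: btw_def ld_def)

lemma btw_trans:
  assumes "btw u x v" "btw x z v"
  shows "btw u z v"
  using assms ld_tri[of u z x] ld_tri[of u v z] by (simp add: btw_def)

lemma btw_both:
  assumes "btw a x b" "btw a p x" "btw x r b"
  shows "btw p x r"
  using assms ld_tri[of a b p] ld_tri[of p b r] ld_tri[of p r x]
  by (simp add: btw_def)

lemma median_exists:
  assumes "u \<in> lists A" "v \<in> lists A" "w \<in> lists A"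
  obtains m where "m \<in> lists A" "btw u m v" "btw u m w" "btw v m w"
proof -
  \<comment> \<open>The pair with the longest common prefix determines the median, which is that
    prefix; the other two cases permute the words.\<close>
  have *: "\<exists>m\<in>lists A. btw u m v \<and> btw u m w \<and> btw v m w"
    if u: "u \<in> lists A" and le: "lcp u w \<le> lcp u v" "lcp v w \<le> lcp u v" for u v w
  proof -
    define m where "m = take (lcp u v) u"
    have m: "m \<in> lists A" using u by (simp add: m_def take_in_lists)
    have lm: "length m = lcp u v" by (simp add: m_def lcp_le_left)
    have 1: "lcp m y = min (lcp u v) (lcp u y)" for y
      using lcp_take[OF lcp_le_left[of u v]] by (simp add: m_def)
    have "lcp u w = lcp v w"
      using lcp_ultra[of u v w] lcp_ultra[of v u w] le lcp_commute[of u v] by simp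
    then have "btw u m v \<and> btw u m w \<and> btw v m w"
      using le lm lcp_commute[of u v] lcp_commute[of u m] lcp_commute[of v m] lcp_le_left[of u v]
      by (simp add: btw_def ld_def 1)
    with m show ?thesis by blast
  qed
  consider "lcp u w \<le> lcp u v" "lcp v w \<le> lcp u v"
    | "lcp u v \<le> lcp u w" "lcp w v \<le> lcp u w"
    | "lcp v u \<le> lcp v w" "lcp w u \<le> lcp v w"
    using lcp_commute[of v w] lcp_commute[of v u] lcp_commute[of w u] by linarith
  then have "\<exists>m\<in>lists A. btw u m v \<and> btw u m w \<and> btw v m w"
  proof cases
    case 1
    then show ?thesis by (rule *[OF assms(1)])
  next
    case 2
    then show ?thesis using *[OF assms(1) 2] btw_sym[of w] by auto
  next
    case 3
    then show ?thesis using *[OF assms(2) 3] btw_sym[of v _ u] btw_sym[of w _ u] by auto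
  qed
  then show thesis using that by blast
qed

lemma ld_eq_0_iff [simp]: "ld u v = 0 \<longleftrightarrow> u = v"
proof
  assume "ld u v = 0"
  then have "lcp u v = length u" "lcp u v = length v"
    using lcp_le_left[of u v] lcp_le_right[of u v] by (auto simp: ld_def)
  then show "u = v" by (metis lcp_eq_length_iff lcp_commute prefix_order.antisym)
qed simp

text \<open>The step towards \<open>v\<close> deletes the last letter of \<open>u\<close> unless
  \<open>u\<close> is a prefix of \<open>v\<close>. Since the new word is a prefix of an endpoint,
  geodesics stay inside every prefix-closed set of words, such as \<open>lists A\<close> or
  \<open>tree_words q\<close>.\<close>

lemma next_vertex:
  assumes "u \<noteq> v"
  obtains u' where "(\<exists>n. u' = take n u) \<or> (\<exists>n. u' = take n v)" "ld u u' = 1" "ld u' v = ld u v - 1"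
proof (cases "prefix u v")
  case False
  then have lt: "lcp u v < length u" by (rule lcp_less_nonprefix)
  define u' where "u' = take (length u - 1) u"
  have "lcp u' y = min (length u - 1) (lcp u y)" for y
    by (simp add: u'_def lcp_take)
  then have "ld u u' = 1" "ld u' v = ld u v - 1"
    using lt lcp_commute[of u u'] by (auto simp: ld_def u'_def)
  with that show thesis unfolding u'_def by blast
next
  case True
  then obtain w where v: "v = u @ w" by (auto elim: prefixE)
  with assms obtain c w' where w: "w = c # w'" by (cases w) auto
  have "ld u (u @ [c]) = 1" by simp
  moreover have "ld (u @ [c]) v = ld u v - 1"
    using ld_append_left(2)[of "u @ [c]" w'] by (simp add: v w)
  moreover have "u @ [c] = take (Suc (length u)) v" by (simp add: v w)
  ultimately show thesis using that by blast
qed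

lemma ld_nat: "ld u v = real (length u + length v - 2 * lcp u v)"
  using lcp_le_left[of u v] lcp_le_right[of u v] by (simp add: ld_def of_nat_diff)

text \<open>If consecutive images are close, the image of a geodesic cannot jump over a vertex \<open>p\<close>
  that separates the images of the endpoints.\<close>

lemma coarse_passing:
  assumes step: "\<And>x y. x \<in> lists A \<Longrightarrow> y \<in> lists A \<Longrightarrow> ld x y = 1 \<Longrightarrow> ld (f x) (f y) \<le> M"
    and "u \<in> lists A" "v \<in> lists A" and p: "btw (f u) p (f v)" and "0 \<le> M"
  shows "\<exists>z\<in>lists A. btw u z v \<and> ld (f z) p \<le> M"
proof -
  have "\<forall>u\<in>lists A. ld u v = real n \<longrightarrow> btw (f u) p (f v) \<longrightarrow> (\<exists>z\<in>lists A. btw u z v \<and> ld (f z) p \<le> M)" for n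
  proof (induction n)
    case 0
    show ?case
    proof (intro ballI impI)
      fix u assume u: "u \<in> lists A" "ld u v = real 0" "btw (f u) p (f v)"
      then have "u = v" by simp
      then have "ld (f u) p = 0" using u(3) ld_nonneg[of "f u" p] ld_nonneg[of p "f u"]
        by (simp add: btw_def ld_sym)
      then show "\<exists>z\<in>lists A. btw u z v \<and> ld (f z) p \<le> M"
        using u \<open>0 \<le> M\<close> by (intro bexI[of _ u]) auto
    qed
  next
    case (Suc n)
    show ?case
    proof (intro ballI impI)
      fix u assume u: "u \<in> lists A" "ld u v = real (Suc n)" "btw (f u) p (f v)"
      obtain u' where u': "u' \<in> lists A" "ld u u' = 1" "ld u' v = ld u v - 1"
        using next_vertex[of u v] u assms(3) take_in_lists by (metis ld_eq_0_iff of_nat_eq_0_iff nat.distinct(2))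
      have st: "ld (f u) (f u') \<le> M" using step u u' by blast
      have bt: "btw u u' v" using u' by (simp add: btw_def)
      show "\<exists>z\<in>lists A. btw u z v \<and> ld (f z) p \<le> M"
      proof (cases "btw (f u) p (f u')")
        case True
        then have "ld (f u) p \<le> M" using st ld_nonneg[of p "f u'"] unfolding btw_def by linarith
        then show ?thesis using u by (intro bexI[of _ u]) auto
      next
        case False
        \<comment> \<open>By the four-point condition a point between \<open>f u\<close> and
          \<open>f v\<close> lies between \<open>f u\<close> and \<open>f u'\<close> or between
          \<open>f u'\<close> and \<open>f v\<close>.\<close>
        have "btw (f u') p (f v)"
          using ld_four[of "f u" p "f u'" "f v"] False u(3) ld_four[of "f u" "f v" p "f u'"]
            ld_tri[of "f u" "f u'" p] ld_tri[of "f u'" "f v" p] ld_sym[of p "f u'"] ld_sym[of "f v" "f u'"]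
            ld_sym[of "f v" p]
          unfolding btw_def le_max_iff_disj by linarith
        then obtain z where "z \<in> lists A" "btw u' z v" "ld (f z) p \<le> M"
          using Suc u' u by force
        then show ?thesis using bt btw_trans by blast
      qed
    qed
  qed
  then show ?thesis using assms ld_nat by blast
qed

locale words = scale_set L for L +
  fixes q :: nat
  assumes q2: "2 \<le> q"
begin

abbreviation "X \<equiv> lists {..<q}"

end

sublocale words \<subseteq> coarse_space L "lists {..<q}" ld
  by unfold_locales (auto simp: ld_sym ld_tri)

context words begin

lemma S_passing:
  assumes "f \<in> S"
  obtains M where "0 \<le> M" "\<And>u v p. u \<in> X \<Longrightarrow> v \<in> X \<Longrightarrow> btw (f u) p (f v) \<Longrightarrow>
     \<exists>z\<in>X. btw u z v \<and> ld (f z) p \<le> M"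
proof -
  obtain B where B: "\<forall>x\<in>X. \<forall>y\<in>X. ld x y \<le> 1 \<longrightarrow> ld (f x) (f y) \<le> B"
    using qie_upper[OF S_qie[OF assms]] by blast
  show thesis
    by (rule that[of "max B 0"], simp, rule coarse_passing) (use B in \<open>auto simp: max.coboundedI1\<close>)
qed

text \<open>The branch point of \<open>f x\<close> and \<open>f y\<close> lies between them, hence
  is close to \<open>f z\<close> for some \<open>z\<close> between \<open>x\<close> and
  \<open>y\<close>. If it is near the root, then so is \<open>z\<close>, and \<open>lcp x y\<close>
  is at most \<open>length z\<close>. Applied to coarse inverses, this keeps sets with disjoint
  traces on the boundary separated.\<close>

lemma S_proper:
  assumes f: "f \<in> S"
  shows "\<exists>C'. \<forall>x\<in>X. \<forall>y\<in>X. real (lcp (f x) (f y)) \<le> C \<longrightarrow> real (lcp x y) \<le> C'"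
proof -
  obtain M where M: "0 \<le> M" "\<And>u v p. u \<in> X \<Longrightarrow> v \<in> X \<Longrightarrow> btw (f u) p (f v) \<Longrightarrow>
     \<exists>z\<in>X. btw u z v \<and> ld (f z) p \<le> M" using S_passing[OF f] by blast
  obtain B where B: "\<forall>x\<in>X. \<forall>y\<in>X. ld (f x) (f y) \<le> M + C + length (f []) \<longrightarrow> ld x y \<le> B"
    using qie_lower[OF S_qie[OF f]] by blast
  have "real (lcp x y) \<le> B" if xy: "x \<in> X" "y \<in> X" "real (lcp (f x) (f y)) \<le> C" for x y
  proof -
    define p where "p = take (lcp (f x) (f y)) (f x)"
    have le: "lcp (f x) (f y) \<le> length (f x)" by (rule lcp_le_left)
    have lp: "length p = lcp (f x) (f y)" using le by (simp add: p_def)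
    have lcpp: "lcp p z = min (lcp (f x) (f y)) (lcp (f x) z)" for z
      using lcp_take[OF le] by (simp add: p_def)
    have "btw (f x) p (f y)"
      using le lp lcp_commute[of "f x" p] by (simp add: btw_def ld_def lcpp)
    then obtain z where z: "z \<in> X" "btw x z y" "ld (f z) p \<le> M" using M(2)[OF xy(1,2)] by blast
    have "ld (f z) (f []) \<le> ld (f z) p + ld p (f [])" by (rule ld_tri)
    also have "ld p (f []) \<le> length p + length (f [])" by (simp add: ld_def)
    finally have "ld (f z) (f []) \<le> M + C + length (f [])" using z xy lp by linarith
    then have "ld z [] \<le> B" using B z(1) lists.Nil by blast
    then show ?thesis using btw_lcp_le[OF z(2)] by simp
  qed
  then show ?thesis by blast
qed

text \<open>The Morse lemma, with distance to a geodesic measured by the excess in the triangle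
  inequality. Both halves of the geodesic must pass, under \<open>f\<close>, near the median of the
  three images; the points \<open>p\<close> and \<open>r\<close> where they do so are close to each
  other and trap \<open>x\<close> between them.\<close>

lemma morse:
  assumes f: "f \<in> S"
  shows "\<exists>M. \<forall>a\<in>X. \<forall>b\<in>X. \<forall>x\<in>X. btw a x b \<longrightarrow> ld (f a) (f x) + ld (f x) (f b) - ld (f a) (f b) \<le> M"
proof -
  obtain M where M: "0 \<le> M" "\<And>u v p. u \<in> X \<Longrightarrow> v \<in> X \<Longrightarrow> btw (f u) p (f v) \<Longrightarrow>
     \<exists>z\<in>X. btw u z v \<and> ld (f z) p \<le> M" using S_passing[OF f] by blast
  obtain B where B: "\<forall>x\<in>X. \<forall>y\<in>X. ld (f x) (f y) \<le> 2 * M \<longrightarrow> ld x y \<le> B"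
    using qie_lower[OF S_qie[OF f]] by blast
  obtain D where D: "\<forall>x\<in>X. \<forall>y\<in>X. ld x y \<le> B \<longrightarrow> ld (f x) (f y) \<le> D"
    using qie_upper[OF S_qie[OF f]] by blast
  \<comment> \<open>The excess is twice the distance from \<open>f x\<close> to the median
    \<open>m\<close>.\<close>
  have "ld (f a) (f x) + ld (f x) (f b) - ld (f a) (f b) \<le> 2 * (D + M)"
    if abx: "a \<in> X" "b \<in> X" "x \<in> X" "btw a x b" for a b x
  proof -
    obtain m where m: "m \<in> X" "btw (f a) m (f b)" "btw (f a) m (f x)" "btw (f b) m (f x)"
      by (rule median_exists[OF S_closed[OF f abx(1)] S_closed[OF f abx(2)] S_closed[OF f abx(3)]])
    obtain p where p: "p \<in> X" "btw a p x" "ld (f p) m \<le> M" using M(2)[OF abx(1,3) m(3)] by blast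
    have "btw (f x) m (f b)" using m(4) by (metis btw_def ld_sym add.commute)
    then obtain r where r: "r \<in> X" "btw x r b" "ld (f r) m \<le> M" using M(2)[OF abx(3,2)] by blast
    have pxr: "btw p x r" using btw_both[OF abx(4)] p r by blast
    have "ld (f p) (f r) \<le> 2 * M" using ld_tri[of "f p" "f r" m] p r by (simp add: ld_sym)
    then have "ld p r \<le> B" using B p r by blast
    then have "ld p x \<le> B" using pxr ld_nonneg[of x r] unfolding btw_def by linarith
    then have "ld (f p) (f x) \<le> D" using D p abx by blast
    then have "ld m (f x) \<le> D + M" using ld_tri[of m "f x" "f p"] p by (simp add: ld_sym)
    moreover have "ld (f x) (f b) = ld m (f b) + ld m (f x)"
      using m(4) unfolding btw_def by (simp add: ld_sym)
    moreover have "ld (f a) (f x) = ld (f a) m + ld m (f x)"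
      using m(3) by (simp add: btw_def)
    moreover have "ld (f a) (f b) = ld (f a) m + ld m (f b)"
      using m(2) by (simp add: btw_def)
    ultimately show ?thesis by (simp add: algebra_simps)
  qed
  then show ?thesis by blast
qed

text \<open>In whichever direction \<open>z\<close> lies, \<open>x\<close> separates it from two of
  the three ends, and for this pair the excess at \<open>z\<close> is exactly twice
  \<open>ld z x\<close>.\<close>

lemma tripod:
  assumes "\<not> prefix x w" "i \<noteq> j"
    and "prefix (x @ [i]) u" "prefix (x @ [j]) v"
    and "\<And>a b. (a, b) \<in> {(u, v), (u, w), (v, w)} \<Longrightarrow> ld a z + ld z b - ld a b \<le> M"
    and "btw u x v" "btw u x w" "btw v x w"
  shows "2 * ld z x \<le> M"
proof -
  have g: "btw a x z" if "\<not> prefix (x @ [k]) z" "prefix (x @ [k]) a" for k a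
  proof -
    obtain t where a: "a = x @ [k] @ t" using \<open>prefix (x @ [k]) a\<close> by (auto elim: prefixE)
    have 1: "ld a z = length t + ld (x @ [k]) z" using ld_gate[OF that(1), of t] by (simp add: a)
    have "lcp (x @ [k]) z \<le> length x" using lcp_less_nonprefix[OF that(1)] by simp
    then have "lcp (x @ [k]) z = lcp x z"
      using lcp_take[of "length x" "x @ [k]" z] by simp
    then show ?thesis using 1 by (simp add: btw_def ld_def a)
  qed
  have key: "2 * ld z x \<le> M" if "btw a x z" "btw b x z" "(a, b) \<in> {(u, v), (u, w), (v, w)}" for a b
    using that(1,2) assms(5)[OF that(3)] that(3) assms(6-8) ld_sym[of a z] ld_sym[of b z] ld_sym[of z x] ld_sym[of b x]
    unfolding btw_def by auto
  have n: "\<not> prefix (x @ [i]) z \<or> \<not> prefix (x @ [j]) z" using \<open>i \<noteq> j\<close> by (auto simp: prefix_def)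
  show ?thesis
  proof (cases "prefix x z")
    case True
    then obtain t where z: "z = x @ t" by (auto elim: prefixE)
    have "btw w x z" using ld_gate[OF assms(1), of t] by (simp add: btw_def z ld_sym)
    then show ?thesis using n g assms(3,4) key by blast
  next
    case False
    then have "\<not> prefix (x @ [k]) z" for k by (meson append_prefixD)
    then show ?thesis using g assms(3,4) key by blast
  qed
qed

text \<open>If no branch is displaced, then for every \<open>x\<close> other than the root there are
  words in two child branches of \<open>x\<close> and in a sibling branch whose images stay in these
  branches. The geodesics between the words meet at \<open>x\<close>, and so do those between the
  images. The Morse lemma puts \<open>f x\<close> close to the latter, hence close to
  \<open>x\<close>, uniformly in \<open>x\<close>.\<close>

lemma displaced_branch:
  assumes f: "f \<in> S" and nontriv: "\<not> near X f id"
  obtains a where "a \<in> X" "\<And>w. w \<in> X \<Longrightarrow> \<not> prefix a (f (a @ w))"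
proof -
  have "\<exists>a\<in>X. \<forall>w\<in>X. \<not> prefix a (f (a @ w))"
  proof (rule ccontr)
    assume "\<not> ?thesis"
    then have all: "\<And>a. a \<in> X \<Longrightarrow> \<exists>w\<in>X. prefix a (f (a @ w))" by blast
    obtain M where M: "\<forall>a\<in>X. \<forall>b\<in>X. \<forall>x\<in>X. btw a x b \<longrightarrow>
       ld (f a) (f x) + ld (f x) (f b) - ld (f a) (f b) \<le> M" using morse[OF f] by blast
    have bound: "2 * ld (f x) x \<le> M" if x: "x \<in> X" "x \<noteq> []" for x
    proof -
      obtain y k where xy: "x = y @ [k]" using x by (cases x rule: rev_cases) auto
      \<comment> \<open>The letter of a sibling of \<open>x\<close>; it exists, like the two
        children used below, because \<open>q\<close> is at least 2.\<close>
      define j where "j = (if k = 0 then 1 else 0 :: nat)"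
      have y: "y @ [j] \<in> X" "j \<noteq> k" using x q2 by (auto simp: xy j_def)
      have x01: "x @ [0] \<in> X" "x @ [1] \<in> X" using x q2 by auto
      obtain w1 w2 w3 where w: "w1 \<in> X" "w2 \<in> X" "w3 \<in> X"
        and pf: "prefix (x @ [0]) (f (x @ [0] @ w1))"
          "prefix (x @ [1]) (f (x @ [1] @ w2))" "prefix (y @ [j]) (f (y @ [j] @ w3))"
        using all[OF x01(1)] all[OF x01(2)] all[OF y(1)] by auto
      have np: "\<not> prefix x (y @ [j] @ t)" for t using y by (auto simp: xy)
      have np3: "\<not> prefix x (f (y @ [j] @ w3))" using pf(3) np unfolding prefix_def by (metis append.assoc)
      have b: "btw (x @ [0] @ s) x (x @ [1] @ t)" for s t
        using ld_append[of x "[0] @ s" "[1] @ t"] ld_append_left[of x] by (simp add: btw_def ld_def)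
      have b': "btw (x @ s) x (y @ [j] @ t)" for s t
        using ld_gate[OF np, of s t] by (simp add: btw_def)
      have b'': "btw (f u) x (f v)" if "prefix x (f u)" "\<not> prefix x (f v)" for u v
        using that by (auto elim!: prefixE simp: btw_def ld_gate)
      show ?thesis
      proof (rule tripod[OF np3 zero_neq_one pf(1,2)])
        show "btw (f (x @ [0] @ w1)) x (f (x @ [1] @ w2))"
          using pf b by (auto elim!: prefixE)
        show "btw (f (x @ [0] @ w1)) x (f (y @ [j] @ w3))" "btw (f (x @ [1] @ w2)) x (f (y @ [j] @ w3))"
          using b''[OF _ np3] pf append_prefixD by blast+
        fix a b assume "(a, b) \<in> {(f (x @ [0] @ w1), f (x @ [1] @ w2)),
           (f (x @ [0] @ w1), f (y @ [j] @ w3)), (f (x @ [1] @ w2), f (y @ [j] @ w3))}"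
        then consider "a = f (x @ [0] @ w1)" "b = f (x @ [1] @ w2)"
          | "a = f (x @ [0] @ w1)" "b = f (y @ [j] @ w3)"
          | "a = f (x @ [1] @ w2)" "b = f (y @ [j] @ w3)" by blast
        moreover have "x @ [0] @ w1 \<in> X" "x @ [1] @ w2 \<in> X" "y @ [j] @ w3 \<in> X"
          using x01 y w by auto
        ultimately show "ld a (f x) + ld (f x) b - ld a b \<le> M"
          using M x(1) b[of w1 w2] b'[of "[0] @ w1" w3] b'[of "[1] @ w2" w3] by cases blast+
      qed
    qed
    have "near X f id" unfolding near_def
    proof (intro exI ballI)
      fix x assume x: "x \<in> X"
      show "ld (f x) (id x) \<le> max (M / 2) (ld (f []) [])"
      proof (cases "x = []")
        case False
        then show ?thesis using bound[OF x] by simp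
      qed simp
    qed
    with nontriv show False by blast
  qed
  then show thesis using that by blast
qed

end

section \<open>Maps permuting branches\<close>

definition prefix_free :: "'i set \<Rightarrow> ('i \<Rightarrow> 'a list) \<Rightarrow> bool" where
  "prefix_free I b \<longleftrightarrow> (\<forall>i\<in>I. \<forall>j\<in>I. prefix (b i) (b j) \<longrightarrow> i = j)"

text \<open>A single \<open>g\<close> acts in all branches, which makes its constants
  uniform.\<close>

definition branch_map ::
  "'i set \<Rightarrow> ('i \<Rightarrow> 'a list) \<Rightarrow> ('i \<Rightarrow> 'a list) \<Rightarrow> ('a list \<Rightarrow> 'a list) \<Rightarrow> 'a list \<Rightarrow> 'a list" where
  "branch_map I b b' g x =
     (if \<exists>i\<in>I. prefix (b i) x
      then let i = (SOME i. i \<in> I \<and> prefix (b i) x) in b' i @ g (drop (length (b i)) x)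
      else x)"

lemma prefix_free_unique:
  assumes "prefix_free I b" "i \<in> I" "j \<in> I" "prefix (b i) x" "prefix (b j) x"
  shows "i = j"
  using assms prefix_same_cases[OF assms(4,5)] unfolding prefix_free_def by blast

lemma branch_map_branch:
  assumes "prefix_free I b" "i \<in> I"
  shows "branch_map I b b' g (b i @ w) = b' i @ g w"
proof -
  have "(SOME j. j \<in> I \<and> prefix (b j) (b i @ w)) = i"
    by (rule some_equality) (use assms prefix_free_unique[OF assms(1)] in \<open>auto intro: prefixI\<close>)
  then show ?thesis using assms by (auto simp: branch_map_def Let_def)
qed

lemma branch_map_outside: "(\<And>i. i \<in> I \<Longrightarrow> \<not> prefix (b i) x) \<Longrightarrow> branch_map I b b' g x = x"
  by (auto simp: branch_map_def)

lemma ld_gate2: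
  assumes "prefix_free I b" "i \<in> I" "j \<in> I" "i \<noteq> j"
  shows "ld (b i @ w) (b j @ v) = real (length w) + real (length v) + ld (b i) (b j)"
proof -
  have "\<not> prefix (b i) (b j @ v)" "\<not> prefix (b j) (b i)"
    using prefix_free_unique[OF assms(1-3)] assms(4) by (auto intro: prefixI)
  then show ?thesis using ld_gate[of "b i" "b j @ v" w] ld_gate[of "b j" "b i" v] by (simp add: ld_sym)
qed

lemma ld_quad: "ld x y \<le> ld x x' + ld x' y' + ld y y'"
  using ld_tri[of x y x'] ld_tri[of x' y y'] ld_sym[of y' y] by linarith

text \<open>Words in different branches are joined through the branch roots: \<open>g\<close>
  distorts only the two depths, and the distance of the roots changes by at most
  \<open>2 * C\<close>, however many branches there are. The hypothesis \<open>cover\<close> ensures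
  that the fixed words, which lie outside all old branches, lie outside the new ones too.\<close>

lemma branch_map_bounds:
  fixes l K C :: real
  assumes pf: "prefix_free I b" "prefix_free I b'"
    and cover: "\<forall>i\<in>I. \<forall>y. prefix (b' i) y \<longrightarrow> (\<exists>j\<in>I. prefix (b j) y)"
    and disp: "\<forall>i\<in>I. ld (b i) (b' i) \<le> C" and C: "0 \<le> C"
    and l: "1 \<le> l" and K: "0 \<le> K"
    and g: "\<And>i j w v. i \<in> I \<Longrightarrow> j \<in> I \<Longrightarrow> b i @ w \<in> Z \<Longrightarrow> b j @ v \<in> Z \<Longrightarrow>
      inverse l * ld w v - K \<le> ld (g w) (g v) \<and> ld (g w) (g v) \<le> l * ld w v + K"
    and len: "\<And>i w. i \<in> I \<Longrightarrow> b i @ w \<in> Z \<Longrightarrow>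
      inverse l * length w - K \<le> length (g w) \<and> length (g w) \<le> l * length w + K"
    and xy: "x \<in> Z" "y \<in> Z"
  defines "f \<equiv> branch_map I b b' g"
  shows "inverse l * ld x y - (2 * K + 2 * C) \<le> ld (f x) (f y) \<and>
     ld (f x) (f y) \<le> l * ld x y + (2 * K + 2 * C)"
proof -
  have il: "inverse l * t \<le> t" and ll: "t \<le> l * t" if "0 \<le> t" for t :: real
    using l that mult_right_mono[of "inverse l" 1 t] mult_right_mono[of 1 l t]
    by (auto simp: inverse_le_1_iff)
  have fb: "f (b i @ w) = b' i @ g w" if "i \<in> I" for i w
    using branch_map_branch[OF pf(1) that] by (simp add: f_def)
  have fo: "f z = z" if "\<not> (\<exists>i\<in>I. prefix (b i) z)" for z
    using that by (auto simp: f_def intro: branch_map_outside)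
  have mixed: "inverse l * ld z t - (2 * K + 2 * C) \<le> ld (f z) (f t) \<and>
     ld (f z) (f t) \<le> l * ld z t + (2 * K + 2 * C)"
    if z: "z = b i @ w" "i \<in> I" "z \<in> Z" and t: "\<not> (\<exists>i\<in>I. prefix (b i) t)" for z t i w
  proof -
    have zt: "ld z t = real (length w) + ld (b i) t" using z t ld_gate by blast
    have "\<not> prefix (b' i) t" using cover z(2) t by blast
    then have ft: "ld (f z) (f t) = real (length (g w)) + ld (b' i) t"
      using fo[OF t] by (simp add: z fb ld_gate)
    have "ld (b' i) t \<le> ld (b i) t + C" "ld (b i) t \<le> ld (b' i) t + C"
      using bspec[OF disp z(2)] ld_tri[of "b' i" t "b i"] ld_tri[of "b i" t "b' i"] ld_sym[of "b i" "b' i"]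
      by auto
    moreover have "b i @ w \<in> Z" using z by simp
    ultimately show ?thesis
      using len[OF z(2), of w] il[of "ld (b i) t"] ll[of "ld (b i) t"] K C ld_nonneg[of "b i" t]
      unfolding zt ft by (simp add: algebra_simps)
  qed
  consider (out) "\<not> (\<exists>i\<in>I. prefix (b i) x)" "\<not> (\<exists>i\<in>I. prefix (b i) y)"
    | (left) i w where "x = b i @ w" "i \<in> I" "\<not> (\<exists>i\<in>I. prefix (b i) y)"
    | (right) i w where "y = b i @ w" "i \<in> I" "\<not> (\<exists>i\<in>I. prefix (b i) x)"
    | (both) i j w v where "x = b i @ w" "i \<in> I" "y = b j @ v" "j \<in> I"
    unfolding prefix_def by blast
  then show ?thesis
  proof cases
    case out
    then show ?thesis using fo il[of "ld x y"] ll[of "ld x y"] K C by simp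
  next
    case left
    then show ?thesis using mixed xy by blast
  next
    case right
    then show ?thesis using mixed[of y i w x] xy by (simp add: ld_sym)
  next
    case both
    show ?thesis
    proof (cases "i = j")
      case True
      then show ?thesis using both g[of i i w v] xy K C by (simp add: fb)
    next
      case False
      have 1: "ld x y = real (length w) + real (length v) + ld (b i) (b j)"
        using ld_gate2[OF pf(1)] both False by blast
      have 2: "ld (f x) (f y) = real (length (g w)) + real (length (g v)) + ld (b' i) (b' j)"
        using ld_gate2[OF pf(2)] both False by (simp add: fb)
      have "ld (b' i) (b' j) \<le> ld (b i) (b j) + 2 * C" "ld (b i) (b j) \<le> ld (b' i) (b' j) + 2 * C"
        using ld_quad[of "b i" "b j" "b' i" "b' j"] ld_quad[of "b' i" "b' j" "b i" "b j"]
          disp both ld_sym[of "b i"] ld_sym[of "b j"] by (smt (verit))+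
      moreover have "b i @ w \<in> Z" "b j @ v \<in> Z" using both xy by auto
      ultimately show ?thesis
        using len[OF both(2), of w] len[OF both(4), of v] il[of "ld (b i) (b j)"] ll[of "ld (b i) (b j)"]
          ld_nonneg[of "b i" "b j"]
        unfolding 1 2 by (simp add: algebra_simps)
    qed
  qed
qed

lemma branch_map_almost_isometry:
  assumes "prefix_free I b" "prefix_free I b'"
    and "\<forall>i\<in>I. \<forall>y. prefix (b' i) y \<longrightarrow> (\<exists>j\<in>I. prefix (b j) y)"
    and "\<forall>i\<in>I. ld (b i) (b' i) \<le> C" and "0 \<le> C"
  shows "\<bar>ld (branch_map I b b' id x) (branch_map I b b' id y) - ld x y\<bar> \<le> 2 * C"
  using branch_map_bounds[OF assms, where l = 1 and K = 0 and Z = UNIV and g = id and x = x and y = y] by auto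

definition lift :: "'a list \<Rightarrow> ('a list \<Rightarrow> 'a list) \<Rightarrow> 'a list \<Rightarrow> 'a list" where
  "lift b = branch_map {()} (\<lambda>_. b) (\<lambda>_. b)"

lemma lift_branch [simp]: "lift b g (b @ w) = b @ g w"
  using branch_map_branch[of "{()}" "\<lambda>_. b"] by (simp add: lift_def prefix_free_def)

lemma lift_outside: "\<not> prefix b x \<Longrightarrow> lift b g x = x"
  by (simp add: lift_def branch_map_outside)

definition rep :: "nat \<Rightarrow> 'b list \<Rightarrow> 'b list" where
  "rep n r = concat (replicate n r)"

lemma rep_simps [simp]: "rep 0 r = []" "rep (Suc n) r = r @ rep n r"
  by (simp_all add: rep_def)

lemma rep_add: "rep (m + n) r = rep m r @ rep n r"
  by (induction m) auto

lemma rep_Suc_right: "rep (Suc n) r = rep n r @ r"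
  using rep_add[of n 1 r] by simp

lemma rep_closed: "r \<in> lists A \<Longrightarrow> rep n r \<in> lists A"
  by (induction n) auto

context words begin

lemma branch_map_qie:
  assumes "prefix_free I b" "prefix_free I b'"
    and "\<forall>i\<in>I. \<forall>y. prefix (b' i) y \<longrightarrow> (\<exists>j\<in>I. prefix (b j) y)"
    and "\<forall>i\<in>I. ld (b i) (b' i) \<le> C" and C: "0 \<le> C"
    and g: "qie X g"
  shows "qie X (branch_map I b b' g)"
proof -
  obtain l K where l: "l \<in> L" and K: "0 \<le> K" and
    1: "\<And>x y. x \<in> X \<Longrightarrow> y \<in> X \<Longrightarrow> inverse l * ld x y - K \<le> ld (g x) (g y) \<and>
      ld (g x) (g y) \<le> l * ld x y + K"
    using g unfolding qie_def by blast
  \<comment> \<open>Bounds on lengths come from comparison with the empty word, whose image need not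
    be empty.\<close>
  define K' where "K' = K + length (g [])"
  have K': "0 \<le> K'" "K \<le> K'" using K by (auto simp: K'_def)
  have 2: "inverse l * length x - K' \<le> length (g x) \<and> length (g x) \<le> l * length x + K'"
    if "x \<in> X" for x
    using 1[OF that lists.Nil] ld_tri[of "g x" "g []" "[]"] ld_tri[of "g x" "[]" "g []"]
    by (simp add: K'_def)
  have "inverse l * ld x y - (2 * K' + 2 * C) \<le> ld (branch_map I b b' g x) (branch_map I b b' g y) \<and>
     ld (branch_map I b b' g x) (branch_map I b b' g y) \<le> l * ld x y + (2 * K' + 2 * C)"
    if "x \<in> X" "y \<in> X" for x y
  proof (rule branch_map_bounds[OF assms(1-5) ge_one[OF l] K'(1) _ _ that])
    fix w v i j assume "b i @ w \<in> X" "b j @ v \<in> X"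
    then have "w \<in> X" "v \<in> X" by auto
    then show "inverse l * ld w v - K' \<le> ld (g w) (g v) \<and> ld (g w) (g v) \<le> l * ld w v + K'"
      using 1[of w v] K' by linarith
    show "inverse l * length w - K' \<le> length (g w) \<and> length (g w) \<le> l * length w + K'"
      using 2 \<open>w \<in> X\<close> by blast
  qed
  then show ?thesis unfolding qie_def
    by (intro bexI[OF _ l] exI[of _ "2 * K' + 2 * C"]) (use K' C in auto)
qed

lemma branch_map_closed:
  assumes "prefix_free I b" "\<And>i. i \<in> I \<Longrightarrow> b i \<in> X \<Longrightarrow> b' i \<in> X" "\<And>w. w \<in> X \<Longrightarrow> g w \<in> X" "x \<in> X"
  shows "branch_map I b b' g x \<in> X"
proof (cases "\<exists>i\<in>I. prefix (b i) x")
  case True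
  then obtain i w where "i \<in> I" "x = b i @ w" by (auto elim: prefixE)
  then show ?thesis using assms by (auto simp: branch_map_branch)
next
  case False
  then show ?thesis using assms(4) branch_map_outside[of I b x] by auto
qed

lemma lift_S:
  assumes g: "g \<in> S" and b: "b \<in> X"
  shows "lift b g \<in> S"
  unfolding S_iff
proof (intro conjI)
  show "lift b g \<in> X \<rightarrow> X"
    unfolding lift_def
    by (intro funcsetI branch_map_closed S_closed[OF g]) (use b in \<open>auto simp: prefix_free_def\<close>)
  show "qie X (lift b g)"
    unfolding lift_def using S_qie[OF g]
    by (intro branch_map_qie[where C = 0]) (auto simp: prefix_free_def)
  obtain K where K: "\<And>y. y \<in> X \<Longrightarrow> \<exists>x\<in>X. ld y (g x) \<le> K"
    using g unfolding S_iff codense_def by blast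
  have "\<exists>x\<in>X. ld y (lift b g x) \<le> max K 0" if y: "y \<in> X" for y
  proof (cases "prefix b y")
    case True
    then obtain w where w: "y = b @ w" by (auto elim: prefixE)
    then obtain x where "x \<in> X" "ld w (g x) \<le> K" using K y by auto
    then show ?thesis using b w by (intro bexI[of _ "b @ x"]) auto
  next
    case False
    then show ?thesis using y by (intro bexI[of _ y]) (auto simp: lift_outside)
  qed
  then show "codense X (lift b g)" unfolding codense_def by blast
qed

section \<open>Gluing maps on pieces that are separated on the boundary\<close>

lemma qie_common:
  assumes "qie P f" "qie Q f"
  obtains l K where "l \<in> L" "0 \<le> K"
    "\<And>x y. x \<in> P \<and> y \<in> P \<or> x \<in> Q \<and> y \<in> Q \<Longrightarrow>
       inverse l * ld x y - K \<le> ld (f x) (f y) \<and> ld (f x) (f y) \<le> l * ld x y + K"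
proof -
  obtain l K where l: "l \<in> L" "0 \<le> K" and 1: "\<forall>x\<in>P. \<forall>y\<in>P.
     inverse l * ld x y - K \<le> ld (f x) (f y) \<and> ld (f x) (f y) \<le> l * ld x y + K"
    using assms(1) unfolding qie_def by blast
  obtain m M where m: "m \<in> L" "0 \<le> M" and 2: "\<forall>x\<in>Q. \<forall>y\<in>Q.
     inverse m * ld x y - M \<le> ld (f x) (f y) \<and> ld (f x) (f y) \<le> m * ld x y + M"
    using assms(2) unfolding qie_def by blast
  have lm: "1 \<le> l" "1 \<le> m" using ge_one l m by auto
  \<comment> \<open>The product dominates both constants and lies in \<open>L\<close>.\<close>
  have le: "l \<le> l * m" "m \<le> l * m" using lm by auto
  have ile: "inverse (l * m) \<le> inverse l" "inverse (l * m) \<le> inverse m"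
    using le lm by (auto intro: le_imp_inverse_le simp del: inverse_mult_distrib)
  show thesis
  proof (rule that[of "l * m" "max K M"])
    fix x y assume "x \<in> P \<and> y \<in> P \<or> x \<in> Q \<and> y \<in> Q"
    then show "inverse (l * m) * ld x y - max K M \<le> ld (f x) (f y) \<and> ld (f x) (f y) \<le> l * m * ld x y + max K M"
    proof
      assume "x \<in> P \<and> y \<in> P"
      then show ?thesis
        using 1 mult_right_mono[OF ile(1), of "ld x y"] mult_right_mono[OF le(1), of "ld x y"] ld_nonneg[of x y]
        by (smt (verit))
    next
      assume "x \<in> Q \<and> y \<in> Q"
      then show ?thesis
        using 2 mult_right_mono[OF ile(2), of "ld x y"] mult_right_mono[OF le(2), of "ld x y"] ld_nonneg[of x y]
        by (smt (verit))
    qed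
  qed (use l m mult_in in auto)
qed

text \<open>Both before and after applying \<open>f\<close>, the distance across the pieces is the
  sum of the lengths up to a constant, and within a piece lengths are distorted like distances to a
  fixed base point. Only the additive constant grows.\<close>

lemma qie_glue:
  assumes "qie P f" "qie Q f"
    and sep: "\<And>x y. x \<in> P \<Longrightarrow> y \<in> Q \<Longrightarrow> real (lcp x y) \<le> C"
    and sep': "\<And>x y. x \<in> P \<Longrightarrow> y \<in> Q \<Longrightarrow> real (lcp (f x) (f y)) \<le> C'"
  shows "qie (P \<union> Q) f"
proof (cases "P = {} \<or> Q = {}")
  case True
  then show ?thesis using assms(1,2) by auto
next
  case False
  then obtain p0 q0 where p0: "p0 \<in> P" "q0 \<in> Q" by blast
  obtain l K where l: "l \<in> L" and K: "0 \<le> K" and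
    same: "\<And>x y. x \<in> P \<and> y \<in> P \<or> x \<in> Q \<and> y \<in> Q \<Longrightarrow>
       inverse l * ld x y - K \<le> ld (f x) (f y) \<and> ld (f x) (f y) \<le> l * ld x y + K"
    using qie_common[OF assms(1,2)] by blast
  have l1: "1 \<le> l" "0 < inverse l" using ge_one[OF l] by auto
  have len: "inverse l * length x - (K + inverse l * length x0 + length (f x0)) \<le> length (f x) \<and>
     length (f x) \<le> l * length x + (K + l * length x0 + length (f x0))"
    if "x \<in> P \<and> x0 \<in> P \<or> x \<in> Q \<and> x0 \<in> Q" for x x0
  proof -
    have "real (length x) - length x0 \<le> ld x x0" using ld_ge_length[of x x0] by linarith
    from mult_left_mono[OF this, of "inverse l"]
    have a: "inverse l * length x - inverse l * length x0 \<le> inverse l * ld x x0"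
      using l1 by (simp add: algebra_simps)
    have "ld x x0 \<le> length x + length x0" by (simp add: ld_def)
    from mult_left_mono[OF this, of l]
    have b: "l * ld x x0 \<le> l * length x + l * length x0"
      using l1 by (simp add: algebra_simps)
    have "ld (f x) (f x0) \<le> real (length (f x)) + real (length (f x0))" by (simp add: ld_def)
    then show ?thesis using a b same[OF that] ld_ge_length[of "f x" "f x0"] by linarith
  qed
  define D where "D = (K + l * length p0 + real (length (f p0))) + (K + l * length q0 + real (length (f q0)))
     + (K + inverse l * length p0 + real (length (f p0))) + (K + inverse l * length q0 + real (length (f q0)))
     + 2 * (l * \<bar>C\<bar>) + 2 * \<bar>C'\<bar>"
  have pos: "0 \<le> l * length p0" "0 \<le> l * length q0" "0 \<le> inverse l * length p0" "0 \<le> inverse l * length q0" "0 \<le> l * \<bar>C\<bar>"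
    using l1 by simp_all
  have cross: "inverse l * ld x y - D \<le> ld (f x) (f y) \<and> ld (f x) (f y) \<le> l * ld x y + D"
    if xy: "x \<in> P" "y \<in> Q" for x y
  proof -
    have x: "inverse l * length x - (K + inverse l * length p0 + real (length (f p0))) \<le> length (f x) \<and>
     length (f x) \<le> l * length x + (K + l * length p0 + real (length (f p0)))" using len xy p0 by blast
    have y: "inverse l * length y - (K + inverse l * length q0 + real (length (f q0))) \<le> length (f y) \<and>
     length (f y) \<le> l * length y + (K + l * length q0 + real (length (f q0)))" using len xy p0 by blast
    have a: "l * real (lcp x y) \<le> l * \<bar>C\<bar>" using l1 sep[OF xy] by (intro mult_left_mono) auto
    have b: "0 \<le> inverse l * real (lcp x y)" using l1 by simp
    have e: "inverse l * ld x y = inverse l * length x + inverse l * length y - 2 * (inverse l * lcp x y)"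
      "l * ld x y = l * length x + l * length y - 2 * (l * lcp x y)"
      by (simp_all add: ld_def algebra_simps)
    show ?thesis
      using x y a b pos sep'[OF xy] K abs_ge_self[of C'] unfolding e D_def ld_def[of "f x"]
      by linarith
  qed
  have D: "K \<le> D" using pos K by (simp add: D_def)
  show ?thesis unfolding qie_def
  proof (intro bexI[OF _ l] exI[of _ D] conjI ballI)
    fix x y assume "x \<in> P \<union> Q" "y \<in> P \<union> Q"
    then consider "x \<in> P \<and> y \<in> P \<or> x \<in> Q \<and> y \<in> Q" | "x \<in> P" "y \<in> Q" | "x \<in> Q" "y \<in> P" by blast
    then have "inverse l * ld x y - D \<le> ld (f x) (f y) \<and> ld (f x) (f y) \<le> l * ld x y + D"
    proof cases
      case 1
      show ?thesis using same[OF 1] D by linarith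
    next
      case 2
      then show ?thesis by (rule cross)
    next
      case 3
      then show ?thesis using cross[OF 3(2,1)] by (simp add: ld_sym)
    qed
    then show "inverse l * ld x y - D \<le> ld (f x) (f y)" "ld (f x) (f y) \<le> l * ld x y + D" by auto
  qed (use D K in simp)
qed

text \<open>Two words that share their first \<open>N\<close> letters are both inside or both
  outside \<open>R\<close>, so \<open>R\<close> traces a clopen set on the boundary; membership of
  the finitely many words shorter than \<open>N\<close> is arbitrary.\<close>

definition clopen :: "nat list set \<Rightarrow> bool" where
  "clopen R \<longleftrightarrow> R \<subseteq> X \<and> (\<exists>N. \<forall>x\<in>R. \<forall>y\<in>X - R. lcp x y < N)"

text \<open>Hilbert's hotel: the branches outside \<open>R\<close> are pushed into \<open>r\<close>, the \<open>n\<close>-th copies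
  \<open>r\<^sup>n d\<close> of them being moved to \<open>r\<^sup>n\<^sup>+\<^sup>1 d\<close>.\<close>

lemma swindle:
  assumes R: "clopen R" and r: "r \<in> X" and rR: "\<And>w. w \<in> X \<Longrightarrow> r @ w \<in> R"
  obtains s C N where "\<And>x. x \<in> X \<Longrightarrow> s x \<in> X" "\<And>x y. \<bar>ld (s x) (s y) - ld x y\<bar> \<le> C"
    "\<And>y. y \<in> R \<Longrightarrow> \<exists>x\<in>X. s x = y" "\<And>x. x \<in> X \<Longrightarrow> s x \<in> R \<or> length (s x) < N"
proof -
  obtain N where N: "\<And>x y. x \<in> R \<Longrightarrow> y \<in> X \<Longrightarrow> y \<notin> R \<Longrightarrow> lcp x y < N" and RX: "R \<subseteq> X"
    using R unfolding clopen_def by blast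
  \<comment> \<open>The words of length \<open>N\<close> outside \<open>R\<close> head branches that
    miss \<open>R\<close> altogether. They are the guests to be moved, and the number counts how
    often \<open>r\<close> has been put in front.\<close>
  define I where "I = (UNIV :: nat set) \<times> {d \<in> X - R. length d = N}"
  define b where "b = (\<lambda>(n, d). rep n r @ (d :: nat list))"
  define b' where "b' = (\<lambda>(n, d). b (Suc n, d))"
  have dR: "d @ w \<notin> R" if "(n, d) \<in> I" for n d w
    using N[of "d @ w" d] that by (auto simp: I_def)
  have bX: "b i \<in> X" if "i \<in> I" for i
    using that r by (auto simp: I_def b_def rep_closed)
  have b'X: "b' i \<in> X" if "i \<in> I" for i
    using that r by (auto simp: I_def b_def b'_def rep_closed)
  have pf: "prefix_free I b"
    unfolding prefix_free_def
  proof (intro ballI impI)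
    fix i j assume ij: "i \<in> I" "j \<in> I" "prefix (b i) (b j)"
    obtain n d m e where nd: "i = (n, d)" "j = (m, e)" by (metis surj_pair)
    obtain w where w: "rep m r @ e = rep n r @ d @ w" using ij nd by (auto simp: b_def elim: prefixE)
    have deX: "d \<in> X" "e \<in> X" "length d = length e" using ij by (auto simp: nd I_def)
    then have "rep m r @ e \<in> X" using rep_closed[OF r] by simp
    then have wX: "w \<in> X" unfolding w by simp
    \<comment> \<open>If the powers differ, cancelling the smaller one puts a word of the branch
      \<open>r\<close>, hence of \<open>R\<close>, into the branch of \<open>d\<close> or
      \<open>e\<close>, which misses \<open>R\<close>.\<close>
    consider k where "m = n + Suc k" | k where "n = m + Suc k" | "m = n"
      by (metis less_imp_Suc_add linorder_neqE_nat add_Suc_right)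
    then show "i = j"
    proof cases
      case 1
      then have "rep m r = rep n r @ r @ rep k r" using rep_add[of n "Suc k" r] by simp
      then have "d @ w = r @ rep k r @ e" using w by simp
      moreover have "r @ rep k r @ e \<in> R" using rR[of "rep k r @ e"] rep_closed[OF r] deX by simp
      ultimately show ?thesis using dR[of n d w] ij nd by simp
    next
      case 2
      then have "rep n r = rep m r @ r @ rep k r" using rep_add[of m "Suc k" r] by simp
      then have "e = r @ rep k r @ d @ w" using w by simp
      moreover have "r @ rep k r @ d @ w \<in> R" using rR[of "rep k r @ d @ w"] rep_closed[OF r] deX wX by simp
      ultimately show ?thesis using dR[of m e "[]"] ij nd by simp
    next
      case 3
      then show ?thesis using w deX nd by simp
    qed
  qed
  have pf': "prefix_free I b'"
    unfolding prefix_free_def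
  proof (intro ballI impI)
    fix i j assume ij: "i \<in> I" "j \<in> I" "prefix (b' i) (b' j)"
    obtain n d m e where nd: "i = (n, d)" "j = (m, e)" by (metis surj_pair)
    have "(Suc n, d) \<in> I" "(Suc m, e) \<in> I" using ij by (auto simp: nd I_def)
    moreover have "prefix (b (Suc n, d)) (b (Suc m, e))" using ij(3) by (simp add: nd b'_def)
    ultimately have "(Suc n, d) = (Suc m, e)" using pf unfolding prefix_free_def by blast
    then show "i = j" by (simp add: nd)
  qed
  have cover: "\<forall>i\<in>I. \<forall>y. prefix (b' i) y \<longrightarrow> (\<exists>j\<in>I. prefix (b j) y)"
  proof (intro ballI allI impI)
    fix i y assume "i \<in> I" "prefix (b' i) y"
    then show "\<exists>j\<in>I. prefix (b j) y"
      by (intro bexI[of _ "(Suc (fst i), snd i)"]) (auto simp: I_def b'_def split: prod.splits)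
  qed
  \<comment> \<open>The common prefix \<open>rep n r\<close> cancels, so the displacement is bounded
    independently of \<open>n\<close>.\<close>
  have disp: "ld (b i) (b' i) \<le> 2 * real N + length r" if i: "i \<in> I" for i
  proof -
    obtain n d where nd: "i = (n, d)" by force
    have "b' i = rep n r @ r @ d" using rep_Suc_right[of n r] by (simp add: nd b'_def b_def)
    then have "ld (b i) (b' i) = ld d (r @ d)" by (simp add: nd b_def)
    also have "\<dots> \<le> 2 * real N + length r" using i by (simp add: ld_def nd I_def)
    finally show ?thesis .
  qed
  define s where "s = branch_map I b b' id"
  have sb: "s (b i @ w) = b' i @ w" if "i \<in> I" for i w
    using branch_map_branch[OF pf that] by (simp add: s_def)
  have so: "s x = x" if "\<not> (\<exists>i\<in>I. prefix (b i) x)" for x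
    unfolding s_def using that by (intro branch_map_outside) auto
  show thesis
  proof (rule that[of s "2 * (2 * real N + length r)" N])
    fix x assume x: "x \<in> X"
    show "s x \<in> X" unfolding s_def using x b'X by (intro branch_map_closed[OF pf]) auto
    show "s x \<in> R \<or> length (s x) < N"
    proof (cases "\<exists>i\<in>I. prefix (b i) x")
      case True
      then obtain n d w where i: "(n, d) \<in> I" and xw: "x = b (n, d) @ w" by (auto elim: prefixE)
      have "s x = r @ rep n r @ d @ w" using sb[OF i] by (simp add: xw b'_def b_def)
      moreover have "rep n r @ d @ w \<in> X" using x by (simp add: xw b_def)
      ultimately show ?thesis using rR by simp
    next
      case False
      have "x \<in> R" if "N \<le> length x"
      proof (rule ccontr)
        assume "x \<notin> R"
        define d where "d = take N x"
        have "d \<in> X" using x by (simp add: d_def take_in_lists)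
        moreover have "lcp d x = N" using lcp_take[OF that, of x] that by (simp add: d_def)
        then have "d \<notin> R" using N[of d x] x \<open>x \<notin> R\<close> by auto
        ultimately have "(0, d) \<in> I" using that by (auto simp: I_def d_def)
        moreover have "prefix (b (0, d)) x" by (simp add: b_def d_def take_is_prefix)
        ultimately show False using False by blast
      qed
      then show ?thesis using so[OF False] by force
    qed
  next
    fix x y
    show "\<bar>ld (s x) (s y) - ld x y\<bar> \<le> 2 * (2 * real N + length r)"
      unfolding s_def by (rule branch_map_almost_isometry[OF pf pf' cover]) (use disp in auto)
  next
    fix y assume y: "y \<in> R"
    show "\<exists>x\<in>X. s x = y"
    proof (cases "\<exists>i\<in>I. prefix (b i) y")
      case True
      then obtain n d w where i: "(n, d) \<in> I" and yw: "y = b (n, d) @ w" by (auto elim: prefixE)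
      \<comment> \<open>For \<open>n = 0\<close> the word would lie in a branch that misses
        \<open>R\<close>; hence every guest seen inside \<open>R\<close> has a predecessor.\<close>
      have "n \<noteq> 0" using dR[OF i, of w] y by (cases n) (auto simp: yw b_def)
      then obtain m where m: "n = Suc m" by (cases n) auto
      have "s (b (m, d) @ w) = y" using sb[of "(m, d)" w] i by (simp add: m yw b'_def I_def)
      moreover have "b (m, d) @ w \<in> X" using y RX by (auto simp: yw m b_def)
      ultimately show ?thesis by blast
    next
      case False
      then show ?thesis using so y RX by blast
    qed
  qed
qed

text \<open>A section of the hotel map identifies \<open>R\<close> with all of \<open>X\<close> up
  to bounded error. Only words that \<open>s\<close> sends to a short word outside \<open>R\<close>
  need a substitute preimage, and \<open>r\<close> is close enough for all of them.\<close>

lemma swindle_inverse: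
  assumes R: "clopen R" and r: "r \<in> X" and rR: "\<And>w. w \<in> X \<Longrightarrow> r @ w \<in> R"
  obtains t C where "\<And>y. y \<in> R \<Longrightarrow> t y \<in> X"
    "\<And>x y. x \<in> R \<Longrightarrow> y \<in> R \<Longrightarrow> \<bar>ld (t x) (t y) - ld x y\<bar> \<le> C" "codense R t"
proof -
  obtain s C N where s: "\<And>x. x \<in> X \<Longrightarrow> s x \<in> X" "\<And>x y. \<bar>ld (s x) (s y) - ld x y\<bar> \<le> C"
    "\<And>y. y \<in> R \<Longrightarrow> \<exists>x\<in>X. s x = y" "\<And>x. x \<in> X \<Longrightarrow> s x \<in> R \<or> length (s x) < N"
    using swindle[OF assms] by blast
  then obtain t where t: "\<And>y. y \<in> R \<Longrightarrow> t y \<in> X" "\<And>y. y \<in> R \<Longrightarrow> s (t y) = y" by metis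
  show thesis
  proof (rule that[of t C])
    fix x y assume "x \<in> R" "y \<in> R"
    then show "\<bar>ld (t x) (t y) - ld x y\<bar> \<le> C" using s(2)[of "t x" "t y"] t by simp
  next
    have "\<exists>y\<in>R. ld x (t y) \<le> C + N + length r" if x: "x \<in> X" for x
    proof (cases "s x \<in> R")
      case True
      then show ?thesis using s(2)[of x "t (s x)"] t by (intro bexI[of _ "s x"]) auto
    next
      case False
      then have "length (s x) < N" using s x by blast
      moreover have "r \<in> R" using rR[of "[]"] by simp
      moreover have "ld (s x) r \<le> length (s x) + length r" by (simp add: ld_def)
      ultimately show ?thesis using s(2)[of x "t r"] t by (intro bexI[of _ r]) auto
    qed
    then show "codense R t" unfolding codense_def by blast
  qed (use t in auto)
qed

end

section \<open>Conjugation to a normal form\<close>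

context words begin

lemma clopenI:
  assumes "R \<subseteq> X" "\<And>x y. x \<in> R \<Longrightarrow> y \<in> X \<Longrightarrow> y \<notin> R \<Longrightarrow> real (lcp x y) \<le> C"
  shows "clopen R"
proof -
  have "lcp x y < Suc (nat \<lfloor>C\<rfloor>)" if "x \<in> R" "y \<in> X - R" for x y
    using le_nat_floor[OF assms(2)] that by (simp add: less_Suc_eq_le)
  then show ?thesis using assms(1) unfolding clopen_def by blast
qed

lemma prefix_in_X: "prefix b x \<Longrightarrow> x \<in> X \<Longrightarrow> \<exists>w\<in>X. x = b @ w"
  by (auto elim!: prefixE)

lemma clopen_branch: "p \<in> X \<Longrightarrow> clopen {x \<in> X. prefix p x}"
proof (rule clopenI[where C = "length p"])
  fix x y assume "x \<in> {x \<in> X. prefix p x}" "y \<in> X" "y \<notin> {x \<in> X. prefix p x}"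
  then show "real (lcp x y) \<le> length p"
    using lcp_append_nonprefix[of p y] lcp_le_left[of p y] by (auto elim!: prefixE)
qed auto

text \<open>The map \<open>k\<close> sends \<open>p w\<close> to \<open>a' w\<close> and \<open>y \<in> Q\<close> to \<open>f (a' (t y))\<close>, for some \<open>a'\<close> far below \<open>a\<close>;
  what remains of \<open>X\<close> is matched by two applications of the Hilbert hotel argument.\<close>

lemma normal_form_map:
  assumes f: "f \<in> S" and a: "a \<in> X" and disj: "\<And>w. w \<in> X \<Longrightarrow> \<not> prefix a (f (a @ w))"
    and p: "p \<in> X" and Q: "clopen Q" and pQ: "\<And>y. y \<in> Q \<Longrightarrow> \<not> prefix p y"
    and t: "\<And>y. y \<in> Q \<Longrightarrow> t y \<in> X"
      "\<And>x y. x \<in> Q \<Longrightarrow> y \<in> Q \<Longrightarrow> \<bar>ld (t x) (t y) - ld x y\<bar> \<le> Ct" "codense Q t"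
    and c: "c \<in> X" and free: "\<And>w. w \<in> X \<Longrightarrow> \<not> prefix p (c @ w) \<and> c @ w \<notin> Q"
  obtains k where "k \<in> S" "\<And>y. y \<in> Q \<Longrightarrow> f (k (p @ t y)) = k y"
proof -
  obtain f' where f': "f' \<in> S" "near X (f \<circ> f') id" "near X (f' \<circ> f) id"
    using S_inverse[OF f] by blast
  obtain K1 where K1: "\<And>y. y \<in> X \<Longrightarrow> ld (f (f' y)) y \<le> K1"
    using f'(2) unfolding near_def by auto
  obtain K2 where K2: "\<And>y. y \<in> X \<Longrightarrow> ld (f' (f y)) y \<le> K2"
    using f'(3) unfolding near_def by auto
  have fX: "f x \<in> X" "f' x \<in> X" if "x \<in> X" for x
    using that S_closed f f'(1) by auto
  have QX: "Q \<subseteq> X" using Q by (simp add: clopen_def)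
  have letters: "0 < q" "1 < q" using q2 by auto
  \<comment> \<open>The words \<open>a'\<close> and \<open>r\<close> lie more than
    \<open>K1\<close>, the error of \<open>f \<circ> f'\<close>, below \<open>a\<close>. This lets
    the branch \<open>r\<close> avoid the coarse image of the branch \<open>a'\<close>.\<close>
  define n where "n = nat \<lceil>K1\<rceil>"
  define z where "z = replicate n (0::nat)"
  define a' where "a' = a @ 0 # z"
  define r where "r = a @ 1 # z"
  have zX: "z \<in> X" using letters by (auto simp: z_def in_lists_conv_set)
  have a'X: "a' \<in> X" and rX: "r \<in> X" using a zX letters by (auto simp: a'_def r_def)
  have deep: "\<not> prefix a' (f' y)" if y: "y \<in> X" "prefix (a @ j # z) y" for y j
  proof
    assume "prefix a' (f' y)"
    then obtain w where w: "f' y = a @ 0 # z @ w" by (auto simp: a'_def elim: prefixE)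
    then have "0 # z @ w \<in> X" using fX(2)[OF y(1)] by simp
    then have np: "\<not> prefix a (f (f' y))" using disj w by simp
    obtain v where v: "y = a @ j # z @ v" using y(2) by (auto elim: prefixE)
    have "ld y (f (f' y)) = real (length (j # z @ v)) + ld a (f (f' y))"
      using ld_gate[OF np, of "j # z @ v"] by (simp add: v)
    then have "real n + 1 \<le> ld y (f (f' y))"
      using ld_nonneg[of a "f (f' y)"] by (simp add: z_def)
    moreover have "K1 \<le> real n" by (simp add: n_def real_nat_ceiling_ge)
    ultimately show False using K1[OF y(1)] by (simp add: ld_sym)
  qed
  \<comment> \<open>The image of the branch \<open>a'\<close> under \<open>f\<close> is described
    through the coarse inverse; \<open>R\<close> is the room left for the values of \<open>k\<close>
    on \<open>R0\<close>.\<close>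
  define R where "R = {y \<in> X. \<not> prefix a' y \<and> \<not> prefix a' (f' y)}"
  define R0 where "R0 = {y \<in> X. \<not> prefix p y \<and> y \<notin> Q}"
  have "clopen R"
  proof -
    obtain C where C: "\<forall>x\<in>X. \<forall>y\<in>X. real (lcp (f' x) (f' y)) \<le> length a' \<longrightarrow> real (lcp x y) \<le> C"
      using S_proper[OF f'(1), of "length a'"] by blast
    show ?thesis
    proof (rule clopenI[where C = "max C (length a')"])
      fix x y assume x: "x \<in> R" and y: "y \<in> X" "y \<notin> R"
      then consider "prefix a' y" | "prefix a' (f' y)" by (auto simp: R_def)
      then show "real (lcp x y) \<le> max C (length a')"
      proof cases
        case 1
        then obtain w where "y = a' @ w" by (auto elim: prefixE)
        then have "lcp x y = lcp a' x" using x lcp_append_nonprefix[of a' x] lcp_commute[of x] by (simp add: R_def)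
        then show ?thesis using lcp_le_left[of a' x] by simp
      next
        case 2
        then obtain w where w: "f' y = a' @ w" by (auto elim: prefixE)
        then have "lcp (f' x) (f' y) = lcp a' (f' x)"
          using x lcp_append_nonprefix[of a' "f' x"] lcp_commute[of "f' x"] by (simp add: R_def)
        then have "real (lcp (f' x) (f' y)) \<le> length a'" using lcp_le_left[of a' "f' x"] by simp
        moreover have "x \<in> X" using x by (simp add: R_def)
        ultimately have "real (lcp x y) \<le> C" using C y(1) by blast
        then show ?thesis by simp
      qed
    qed (auto simp: R_def)
  qed
  moreover have "r @ w \<in> R" if "w \<in> X" for w
  proof -
    have "\<not> prefix a' (r @ w)" by (simp add: a'_def r_def)
    moreover have "\<not> prefix a' (f' (r @ w))" using deep[of "r @ w" 1] that rX by (simp add: r_def)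
    ultimately show ?thesis using that rX by (simp add: R_def)
  qed
  ultimately obtain s Cs N where s: "\<And>x. x \<in> X \<Longrightarrow> s x \<in> X" "\<And>x y. \<bar>ld (s x) (s y) - ld x y\<bar> \<le> Cs"
    "\<And>y. y \<in> R \<Longrightarrow> \<exists>x\<in>X. s x = y" "\<And>x. x \<in> X \<Longrightarrow> s x \<in> R \<or> length (s x) < N"
    using swindle[OF _ rX] by blast
  obtain NQ where NQ: "\<forall>x\<in>Q. \<forall>y\<in>X - Q. lcp x y < NQ" using Q by (auto simp: clopen_def)
  have sepR0: "real (lcp x y) \<le> NQ + length p" if x: "x \<in> X" "prefix p x \<or> x \<in> Q" and y: "y \<in> R0" for x y
    using x(2)
  proof
    assume "prefix p x"
    then obtain w where "x = p @ w" by (auto elim: prefixE)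
    then have "lcp x y = lcp p y" using y lcp_append_nonprefix[of p y] by (simp add: R0_def)
    then show ?thesis using lcp_le_left[of p y] by simp
  next
    assume "x \<in> Q"
    then have "lcp x y < NQ" using NQ y by (auto simp: R0_def)
    then show ?thesis by simp
  qed
  have "clopen R0"
  proof (rule clopenI[where C = "NQ + length p"])
    fix x y assume "x \<in> R0" "y \<in> X" "y \<notin> R0"
    then show "real (lcp x y) \<le> NQ + length p"
      using sepR0[of y x] lcp_commute[of x y] by (auto simp: R0_def)
  qed (auto simp: R0_def)
  moreover have "c @ w \<in> R0" if "w \<in> X" for w using free[OF that] that c by (simp add: R0_def)
  ultimately obtain t0 C0 where t0: "\<And>y. y \<in> R0 \<Longrightarrow> t0 y \<in> X"
    "\<And>x y. x \<in> R0 \<Longrightarrow> y \<in> R0 \<Longrightarrow> \<bar>ld (t0 x) (t0 y) - ld x y\<bar> \<le> C0" "codense R0 t0"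
    using swindle_inverse[OF _ c] by blast
  define P where "P = {x \<in> X. prefix p x}"
  define k where "k x = (if prefix p x then a' @ drop (length p) x
     else if x \<in> Q then f (a' @ t x) else s (t0 x))" for x
  have kP: "k (p @ w) = a' @ w" for w by (simp add: k_def)
  have kQ: "k y = f (a' @ t y)" if "y \<in> Q" for y using pQ that by (simp add: k_def)
  have kR: "k y = s (t0 y)" if "y \<in> R0" for y using that by (simp add: k_def R0_def)
  have cases: "x \<in> P \<or> x \<in> Q \<or> x \<in> R0" if "x \<in> X" for x using that by (auto simp: P_def R0_def)
  have P_obt: "\<exists>w\<in>X. x = p @ w" if "x \<in> P" for x using that by (auto simp: P_def elim: prefixE)
  have fk: "f (k (p @ t y)) = k y" if "y \<in> Q" for y using that by (simp add: kP kQ)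
  have kX: "k x \<in> X" if "x \<in> X" for x
    using cases[OF that]
  proof (elim disjE)
    assume "x \<in> P"
    then obtain w where "w \<in> X" "x = p @ w" using P_obt by blast
    then show ?thesis using a'X by (simp add: kP)
  next
    assume "x \<in> Q"
    then show ?thesis using t(1) a'X fX(1) by (simp add: kQ)
  next
    assume "x \<in> R0"
    then show ?thesis using t0(1) s(1) by (simp add: kR)
  qed
  have qP: "qie P k"
  proof (rule qieI_one[where C = 0])
    fix x y assume xy: "x \<in> P" "y \<in> P"
    show "\<bar>ld (k x) (k y) - ld x y\<bar> \<le> 0" using P_obt[OF xy(1)] P_obt[OF xy(2)] kP by auto
  qed
  have "qie Q (\<lambda>y. a' @ t y)" by (rule qieI_one[where C = Ct]) (use t(2) in simp)
  then have "qie Q (\<lambda>y. f (a' @ t y))"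
    by (rule qie_comp[OF _ S_qie[OF f]]) (use t(1) a'X in simp)
  then have qQ: "qie Q k" by (rule qie_cong) (simp add: kQ)
  have qR0: "qie R0 k"
  proof (rule qieI_one[where C = "Cs + C0"])
    fix x y assume xy: "x \<in> R0" "y \<in> R0"
    show "\<bar>ld (k x) (k y) - ld x y\<bar> \<le> Cs + C0"
      using s(2)[of "t0 x" "t0 y"] t0(2)[OF xy] kR xy by simp
  qed
  have "qie (P \<union> Q) k"
  proof (rule qie_glue[OF qP qQ, where C = "length p" and C' = "length a"])
    fix x y assume xy: "x \<in> P" "y \<in> Q"
    obtain w where w: "x = p @ w" using P_obt xy by blast
    have "lcp x y = lcp p y" using lcp_append_nonprefix[OF pQ[OF xy(2)]] by (simp add: w)
    then show "real (lcp x y) \<le> length p" using lcp_le_left[of p y] by simp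
    \<comment> \<open>The values on \<open>P\<close> lie in the branch \<open>a\<close>, those on
      \<open>Q\<close> outside it, because \<open>f\<close> displaces that branch.\<close>
    have "\<not> prefix a (k y)"
      using disj[of "0 # z @ t y"] t(1) zX letters xy by (simp add: kQ a'_def)
    then have "lcp (k x) (k y) = lcp a (k y)"
      using lcp_append_nonprefix[of a "k y" "0 # z @ w"] by (simp add: w kP a'_def)
    then show "real (lcp (k x) (k y)) \<le> length a" using lcp_le_left[of a "k y"] by simp
  qed
  \<comment> \<open>Values in \<open>R\<close> are separated from those on \<open>Q\<close> only
    after applying \<open>f'\<close>; the slack \<open>K2\<close> allows for the difference between
    \<open>f' (f u)\<close> and \<open>u\<close>.\<close>
  moreover obtain C3 where C3: "\<forall>x\<in>X. \<forall>y\<in>X. real (lcp (f' x) (f' y)) \<le> length a' + K2 \<longrightarrow> real (lcp x y) \<le> C3"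
      using S_proper[OF f'(1), of "length a' + K2"] by blast
  ultimately have "qie ((P \<union> Q) \<union> R0) k"
  proof (intro qie_glue[OF _ qR0, where C = "NQ + length p" and C' = "N + length a' + \<bar>C3\<bar>"])
    fix x y assume xy: "x \<in> P \<union> Q" "y \<in> R0"
    show "real (lcp x y) \<le> NQ + length p"
      using xy QX by (intro sepR0) (auto simp: P_def)
    have ky: "k y \<in> X" using kX xy by (auto simp: R0_def)
    show "real (lcp (k x) (k y)) \<le> N + length a' + \<bar>C3\<bar>"
    proof (cases "k y \<in> R")
      case False
      then have "length (k y) < N" using s(4) t0(1) xy kR by auto
      then show ?thesis using lcp_le_right[of "k x" "k y"] by linarith
    next
      case True
      show ?thesis
      proof (cases "x \<in> Q")
        case False
        then obtain w where w: "x = p @ w" using P_obt xy by blast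
        have "lcp (k x) (k y) = lcp a' (k y)"
          using lcp_append_nonprefix[of a' "k y"] True by (simp add: w kP R_def)
        then show ?thesis using lcp_le_left[of a' "k y"] by simp
      next
        case xQ: True
        define u where "u = a' @ t x"
        have u: "u \<in> X" "k x = f u" using t(1) xQ a'X by (auto simp: u_def kQ)
        have "lcp u (f' (k y)) = lcp a' (f' (k y))"
          using lcp_append_nonprefix[of a' "f' (k y)"] True by (simp add: u_def R_def)
        then have "real (lcp (f' (k y)) u) \<le> length a'"
          using lcp_le_left[of a' "f' (k y)"] lcp_commute[of u] by simp
        then have "real (lcp (f' (k y)) (f' (f u))) \<le> length a' + K2"
          using lcp_le_add_ld[of "f' (k y)" "f' (f u)" u] K2[OF u(1)] ld_sym[of u] by simp
        then have "real (lcp (k y) (f u)) \<le> C3" using C3 ky fX(1)[OF u(1)] by blast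
        then show ?thesis using u(2) lcp_commute[of "f u" "k y"] by simp
      qed
    qed
  qed
  moreover have "(P \<union> Q) \<union> R0 = X" using cases QX by (auto simp: P_def R0_def)
  ultimately have qX: "qie X k" by simp
  obtain Kt where Kt: "\<And>x. x \<in> X \<Longrightarrow> \<exists>y\<in>Q. ld x (t y) \<le> Kt" using t(3) unfolding codense_def by blast
  obtain K0 where K0: "\<And>x. x \<in> X \<Longrightarrow> \<exists>y\<in>R0. ld x (t0 y) \<le> K0" using t0(3) unfolding codense_def by blast
  obtain B where B: "\<forall>x\<in>X. \<forall>y\<in>X. ld x y \<le> Kt \<longrightarrow> ld (f x) (f y) \<le> B"
    using qie_upper[OF S_qie[OF f]] by blast
  have "\<exists>x\<in>X. ld y (k x) \<le> \<bar>B\<bar> + \<bar>K1\<bar> + \<bar>K0 + Cs\<bar>" if y: "y \<in> X" for y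
  proof -
    consider w where "y = a' @ w" "w \<in> X" | w where "f' y = a' @ w" "w \<in> X" | "y \<in> R"
      using y prefix_in_X[of a' y] prefix_in_X[of a' "f' y"] fX(2)[OF y] by (auto simp: R_def)
    then show ?thesis
    proof cases
      case 1
      then show ?thesis using p by (intro bexI[of _ "p @ w"]) (auto simp: kP)
    next
      case 2
      obtain x where x: "x \<in> Q" "ld w (t x) \<le> Kt" using Kt[OF 2(2)] by blast
      have "ld (f (a' @ w)) (f (a' @ t x)) \<le> B" using B x 2 t(1)[OF x(1)] a'X by simp
      then have "ld y (k x) \<le> B + K1"
        using ld_tri[of y "k x" "f (f' y)"] K1[OF y] kQ[OF x(1)] 2 ld_sym[of y] by simp
      then show ?thesis using x QX by (intro bexI[of _ x]) auto
    next
      case 3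
      then obtain v where v: "v \<in> X" "s v = y" using s(3) by blast
      obtain x where x: "x \<in> R0" "ld v (t0 x) \<le> K0" using K0[OF v(1)] by blast
      have "ld y (k x) \<le> K0 + Cs" using s(2)[of v "t0 x"] v x kR[OF x(1)] by simp
      then show ?thesis using x by (intro bexI[of _ x]) (auto simp: R0_def)
    qed
  qed
  then have "codense X k" unfolding codense_def by blast
  then have "k \<in> S" using qX kX by (auto simp: S_iff)
  then show thesis using that fk by blast
qed

text \<open>The equation for \<open>k\<close> says that the conjugate of \<open>f\<close> sends
  \<open>p @ t y\<close> near \<open>y\<close>. As \<open>p\<close>, \<open>Q\<close> and
  \<open>t\<close> do not depend on \<open>f\<close>, different nontrivial classes can be given the
  same behaviour on one branch.\<close>

lemma normal_form:
  assumes "f \<in> S" "\<not> near X f id"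
    and "p \<in> X" "clopen Q" "\<And>y. y \<in> Q \<Longrightarrow> \<not> prefix p y"
    and "\<And>y. y \<in> Q \<Longrightarrow> t y \<in> X"
      "\<And>x y. x \<in> Q \<Longrightarrow> y \<in> Q \<Longrightarrow> \<bar>ld (t x) (t y) - ld x y\<bar> \<le> C" "codense Q t"
    and "c \<in> X" "\<And>w. w \<in> X \<Longrightarrow> \<not> prefix p (c @ w) \<and> c @ w \<notin> Q"
  obtains k k' where "k \<in> S" "k' \<in> S" "near X (k \<circ> k') id" "near X (k' \<circ> k) id"
    "near Q (\<lambda>y. k' (f (k (p @ t y)))) id"
proof -
  obtain a where a: "a \<in> X" "\<And>w. w \<in> X \<Longrightarrow> \<not> prefix a (f (a @ w))"
    using displaced_branch[OF assms(1,2)] by blast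
  obtain k where k: "k \<in> S" "\<And>y. y \<in> Q \<Longrightarrow> f (k (p @ t y)) = k y"
    by (rule normal_form_map[OF assms(1) a assms(3-)]) auto
  obtain k' where k': "k' \<in> S" "near X (k \<circ> k') id" "near X (k' \<circ> k) id"
    using S_inverse[OF k(1)] by blast
  have "Q \<subseteq> X" using assms(4) by (simp add: clopen_def)
  then have "near Q (\<lambda>y. k' (f (k (p @ t y)))) id"
    using k'(3) k(2) unfolding near_def by auto
  then show thesis using that k k' by blast
qed

end

section \<open>Infinite spreading and commutators\<close>

lemma prefix_zeros_one:
  "prefix (replicate m 0 @ [1]) (replicate n 0 @ 1 # w) \<longleftrightarrow> m = (n::nat)" for w :: "nat list"
proof (induction m arbitrary: n)
  case 0
  then show ?case by (cases n) auto
next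
  case (Suc m)
  then show ?case by (cases n) auto
qed

definition zeros_one :: "nat \<Rightarrow> nat list" where
  "zeros_one n = replicate n 0 @ [1]"

text \<open>The positions avoid the branch \<open>01\<close>, onto which a conjugate of \<open>c\<close> carries the branch \<open>00\<close>
  containing the nonnegative positions.\<close>

definition pos :: "int \<Rightarrow> nat list" where
  "pos n = (if 0 \<le> n then [0, 0] @ zeros_one (nat n) else [1] @ zeros_one (nat (- n - 1)))"

lemma prefix_free_zeros_one: "prefix_free UNIV zeros_one"
  using prefix_zeros_one[of _ _ "[]"] by (auto simp: prefix_free_def zeros_one_def)

lemma prefix_free_pos: "prefix_free UNIV pos"
proof -
  have "m = n" if "prefix (pos m) (pos n)" for m n
  proof -
    have "(0 \<le> m) = (0 \<le> n)" using that by (auto simp: pos_def split: if_splits)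
    then show ?thesis
      using that prefix_zeros_one[of _ _ "[]"] by (auto simp: pos_def zeros_one_def split: if_splits)
  qed
  then show ?thesis by (simp add: prefix_free_def)
qed

lemma ld_zeros_one: "ld (zeros_one n) (zeros_one (Suc n)) = 3"
proof -
  have "ld (zeros_one n) (zeros_one (Suc n)) = ld (replicate n 0 @ [1]) (replicate n 0 @ [0, 1::nat])"
    by (simp add: zeros_one_def replicate_append_same[symmetric])
  also have "\<dots> = 3" unfolding ld_append by (simp add: ld_def)
  finally show ?thesis .
qed

lemma ld_pos: "ld (pos n) (pos (n + 1)) \<le> 5"
proof -
  consider "0 \<le> n" | "n = -1" | "n < -1" by linarith
  then show ?thesis
  proof cases
    case 1
    then have "nat (n + 1) = Suc (nat n)" by simp
    then have "ld (pos n) (pos (n + 1)) = ld (zeros_one (nat n)) (zeros_one (Suc (nat n)))"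
      using 1 unfolding pos_def by (simp only: ld_append) simp
    then show ?thesis by (simp add: ld_zeros_one)
  next
    \<comment> \<open>The bound 5 is attained here, between the words 11 and 001; all other
      consecutive positions have distance 3.\<close>
    case 2
    then show ?thesis by (simp add: pos_def zeros_one_def ld_def)
  next
    case 3
    then have "nat (- n - 1) = Suc (nat (- (n + 1) - 1))" by simp
    then have "ld (pos n) (pos (n + 1)) = ld (zeros_one (Suc (nat (- (n + 1) - 1)))) (zeros_one (nat (- (n + 1) - 1)))"
      using 3 unfolding pos_def by (simp only: ld_append) simp
    then show ?thesis by (simp add: ld_zeros_one ld_sym)
  qed
qed

text \<open>Lifted to the branch 00, this map acts as \<open>g\<close> at every \<open>pos n\<close>
  with nonnegative \<open>n\<close>.\<close>

definition spread :: "(nat list \<Rightarrow> nat list) \<Rightarrow> nat list \<Rightarrow> nat list" where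
  "spread = branch_map UNIV zeros_one zeros_one"

definition shift :: "nat list \<Rightarrow> nat list" where
  "shift = branch_map UNIV pos (\<lambda>n. pos (n + 1)) id"

lemma spread_branch: "spread g (zeros_one n @ w) = zeros_one n @ g w"
  by (simp add: spread_def branch_map_branch[OF prefix_free_zeros_one])

lemma spread_outside: "(\<And>n. \<not> prefix (zeros_one n) x) \<Longrightarrow> spread g x = x"
  by (simp add: spread_def branch_map_outside)

lemma shift_pos: "shift (pos n @ w) = pos (n + 1) @ w"
  by (simp add: shift_def branch_map_branch[OF prefix_free_pos])

lemma shift_outside: "(\<And>n. \<not> prefix (pos n) x) \<Longrightarrow> shift x = x"
  by (simp add: shift_def branch_map_outside)

context words begin

lemma zeros_one_X: "zeros_one n \<in> X"
  using q2 by (auto simp: zeros_one_def in_lists_conv_set)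

lemma pos_X: "pos n \<in> X"
  using q2 zeros_one_X by (auto simp: pos_def)

lemma spread_S:
  assumes g: "g \<in> S"
  shows "spread g \<in> S"
  unfolding S_iff
proof (intro conjI)
  show "spread g \<in> X \<rightarrow> X" unfolding spread_def
    by (intro funcsetI branch_map_closed[OF prefix_free_zeros_one] S_closed[OF g])
  show "qie X (spread g)" unfolding spread_def
    by (rule branch_map_qie[OF prefix_free_zeros_one prefix_free_zeros_one _ _ order_refl S_qie[OF g]]) auto
  obtain K where K: "\<And>y. y \<in> X \<Longrightarrow> \<exists>x\<in>X. ld y (g x) \<le> K"
    using g unfolding S_iff codense_def by blast
  have "\<exists>x\<in>X. ld y (spread g x) \<le> max K 0" if y: "y \<in> X" for y
  proof (cases "\<exists>n. prefix (zeros_one n) y")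
    case True
    then obtain n w where w: "y = zeros_one n @ w" by (auto elim: prefixE)
    then obtain x where "x \<in> X" "ld w (g x) \<le> K" using K y by auto
    then show ?thesis using zeros_one_X w
      by (intro bexI[of _ "zeros_one n @ x"]) (auto simp: spread_branch)
  next
    case False
    then show ?thesis using y by (intro bexI[of _ y]) (auto simp: spread_outside)
  qed
  then show "codense X (spread g)" unfolding codense_def by blast
qed

text \<open>Indexing the positions by all integers makes the shift onto; a one-sided shift would
  miss a whole branch.\<close>

lemma shift_S: "shift \<in> S"
  unfolding S_iff
proof (intro conjI)
  have pf: "prefix_free UNIV (\<lambda>n. pos (n + 1))"
    using prefix_free_pos unfolding prefix_free_def by (metis UNIV_I add_right_cancel)
  show "shift \<in> X \<rightarrow> X" unfolding shift_def
    by (intro funcsetI branch_map_closed[OF prefix_free_pos]) (use pos_X in auto)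
  show "qie X shift" unfolding shift_def
    by (rule branch_map_qie[OF prefix_free_pos pf, where C = 5])
      (use ld_pos S_qie[OF S_id] in auto)
  have "\<exists>x\<in>X. ld y (shift x) \<le> 0" if y: "y \<in> X" for y
  proof (cases "\<exists>n. prefix (pos n) y")
    case True
    then obtain n w where w: "y = pos n @ w" by (auto elim: prefixE)
    then show ?thesis using pos_X y shift_pos[of "n - 1" w]
      by (intro bexI[of _ "pos (n - 1) @ w"]) auto
  next
    case False
    then show ?thesis using y by (intro bexI[of _ y]) (auto simp: shift_outside)
  qed
  then show "codense X shift" unfolding codense_def by blast
qed

lemma pos_nonneg: "0 \<le> n \<Longrightarrow> pos n = [0, 0] @ zeros_one (nat n)"
  by (simp add: pos_def)

lemma pos_neg: "n < 0 \<Longrightarrow> pos n = 1 # zeros_one (nat (- n - 1))"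
  by (simp add: pos_def)

text \<open>Conjugation by \<open>shift\<close> moves the copies of \<open>g\<close> from the
  positions from 0 on to those from 1 on, and the missing copy at \<open>pos 0\<close>, the word
  001, is supplied by \<open>lift [0, 0, 1] g\<close>. In this form without inverses the equation is
  exact.\<close>

lemma commutator_identity:
  "lift [0, 0] (spread g) \<circ> shift = lift [0, 0, 1] g \<circ> shift \<circ> lift [0, 0] (spread g)"
proof
  note One_nat_def [simp del]
  fix x
  have F: "lift [0, 0] (spread g) (pos n @ w) = pos n @ g w" if "0 \<le> n" for n w
    using lift_branch[of "[0, 0]" "spread g" "zeros_one (nat n) @ w"] that
    by (simp add: pos_nonneg spread_branch)
  have F': "lift [0, 0] (spread g) (pos n @ w) = pos n @ w" if "n < 0" for n w
    using that by (intro lift_outside) (simp add: pos_neg)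
  have g0: "lift [0, 0, 1] g (pos 0 @ w) = pos 0 @ g w" for w
    using lift_branch[of "[0, 0, 1]" g w] by (simp add: pos_def zeros_one_def)
  have g1: "lift [0, 0, 1] g x = x" if "\<not> prefix (pos 0) x" for x
    using that by (intro lift_outside) (simp add: pos_def zeros_one_def)
  have g2: "lift [0, 0, 1] g (pos n @ w) = pos n @ w" if "n \<noteq> 0" for n w
    using that prefix_free_unique[OF prefix_free_pos, of 0 n "pos n @ w"] by (intro g1) auto
  show "(lift [0, 0] (spread g) \<circ> shift) x = (lift [0, 0, 1] g \<circ> shift \<circ> lift [0, 0] (spread g)) x"
  proof (cases "\<exists>n. prefix (pos n) x")
    case True
    then obtain n w where x: "x = pos n @ w" by (auto elim: prefixE)
    consider "0 \<le> n" | "n = -1" | "n < -1" by linarith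
    then show ?thesis
    proof cases
      case 1
      then show ?thesis by (simp add: x shift_pos F g2)
    next
      case 2
      then show ?thesis using shift_pos[of "-1"] by (simp add: x F F' g0)
    next
      case 3
      then show ?thesis by (simp add: x shift_pos F' g2)
    qed
  next
    case False
    have "lift [0, 0] (spread g) x = x"
    proof (cases "prefix [0, 0] x")
      case True
      then obtain y where y: "x = [0, 0] @ y" by (auto elim: prefixE)
      have "\<not> prefix (zeros_one n) y" for n
      proof
        assume "prefix (zeros_one n) y"
        then have "prefix (pos (int n)) x" by (simp add: pos_nonneg y)
        with False show False by blast
      qed
      then show ?thesis using lift_branch[of "[0, 0]" "spread g" y] by (simp add: y spread_outside)
    qed (rule lift_outside)
    then show ?thesis using False by (simp add: shift_outside g1)
  qed
qed

text \<open>No position is comparable with the word 01, so \<open>shift\<close> fixes the branch 01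
  pointwise and moves nothing into it.\<close>

lemma lift_shift_commute: "lift [0, 1] f \<circ> shift = shift \<circ> lift [0, 1] f"
proof
  fix x
  have np: "\<not> prefix [0, 1] (pos n @ w)" "\<not> prefix (pos n) ([0, 1] @ w)" for n w
    by (auto simp: pos_def)
  show "(lift [0, 1] f \<circ> shift) x = (shift \<circ> lift [0, 1] f) x"
  proof (cases "prefix [0, 1] x")
    case True
    then obtain w where x: "x = [0, 1] @ w" by (auto elim: prefixE)
    have "shift ([0, 1] @ v) = [0, 1] @ v" for v
      by (rule shift_outside[OF np(2)])
    then show ?thesis unfolding x comp_def lift_branch by (simp only: lift_branch)
  next
    case False
    have "\<not> prefix [0, 1] (shift x)"
    proof (cases "\<exists>n. prefix (pos n) x")
      case True
      then obtain n w where "x = pos n @ w" by (auto elim: prefixE)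
      then show ?thesis by (simp only: shift_pos np not_False_eq_True)
    next
      case no: False
      then show ?thesis using False shift_outside[of x] by auto
    qed
    then show ?thesis using False by (simp add: lift_outside)
  qed
qed

text \<open>On the branch \<open>p\<close> this is the hypothesis on \<open>c\<close>. A word
  outside that branch which \<open>c\<close> sends to \<open>r @ v\<close> must be close to
  \<open>p @ v\<close>, hence \<open>v\<close> is short, and short words are moved only boundedly by
  \<open>f\<close>.\<close>

lemma intertwine:
  assumes c: "c \<in> S" and f: "f \<in> S" and p: "p \<in> X" and r: "r \<in> X"
    and n: "near X (\<lambda>w. c (p @ w)) (\<lambda>w. r @ w)"
  shows "near X (c \<circ> lift p f) (lift r f \<circ> c)"
proof -
  obtain B1 where B1: "\<And>w. w \<in> X \<Longrightarrow> ld (c (p @ w)) (r @ w) \<le> B1" using n unfolding near_def by blast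
  obtain B2 where B2: "\<forall>x\<in>X. \<forall>y\<in>X. ld x y \<le> B1 \<longrightarrow> ld (lift r f x) (lift r f y) \<le> B2"
    using qie_upper[OF S_qie[OF lift_S[OF f r]]] by blast
  obtain B3 where B3: "\<forall>x\<in>X. \<forall>y\<in>X. ld (c x) (c y) \<le> B1 \<longrightarrow> ld x y \<le> B3"
    using qie_lower[OF S_qie[OF c]] by blast
  obtain B4 where B4: "\<forall>x\<in>X. \<forall>y\<in>X. ld x y \<le> B3 \<longrightarrow> ld (f x) (f y) \<le> B4"
    using qie_upper[OF S_qie[OF f]] by blast
  have "ld ((c \<circ> lift p f) x) ((lift r f \<circ> c) x) \<le> \<bar>B1 + B2\<bar> + \<bar>B3 + B4 + length (f [])\<bar>"
    if x: "x \<in> X" for x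
  proof (cases "prefix p x")
    case True
    then obtain w where w: "x = p @ w" "w \<in> X" using prefix_in_X x by blast
    have X: "c x \<in> X" "r @ w \<in> X" "f w \<in> X" using S_closed c f x r w by auto
    have "ld (c (p @ f w)) (r @ f w) \<le> B1" using B1 X by blast
    moreover have "ld (lift r f (c x)) (lift r f (r @ w)) \<le> B2" using B1[OF w(2)] B2[rule_format, of "c x" "r @ w"] X by (simp add: w)
    ultimately show ?thesis
      using ld_tri[of "c (p @ f w)" "lift r f (c x)" "r @ f w"] ld_sym[of "r @ f w"] by (simp add: w)
  next
    case False
    show ?thesis
    proof (cases "prefix r (c x)")
      case False
      then show ?thesis using \<open>\<not> prefix p x\<close> by (simp add: lift_outside)
    next
      case True
      then obtain v where v: "c x = r @ v" "v \<in> X" using prefix_in_X S_closed[OF c x] by blast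
      have "ld (p @ v) x \<le> B3" using B1[OF v(2)] B3 x p v by simp
      then have lv: "length v \<le> B3" using ld_gate[OF False, of v] ld_nonneg[of p x] by linarith
      then have "ld (f v) (f []) \<le> B4" using B4 v(2) by simp
      then have "ld v (f v) \<le> B3 + B4 + length (f [])"
        using lv ld_tri[of v "f v" "[]"] ld_tri[of "[]" "f v" "f []"] ld_sym[of "f []"] by simp
      then show ?thesis using False by (simp add: lift_outside v)
    qed
  qed
  then show ?thesis unfolding near_def by blast
qed

text \<open>Inside the branch \<open>g0\<close> copies \<open>g\<close>. If \<open>g\<close> takes a
  word \<open>x\<close> of the branch out of it, then \<open>g (g x)\<close> is close to
  \<open>g x\<close>, so \<open>x\<close> is close to \<open>g x\<close>. The geodesic joining these
  two passes through \<open>b\<close>, which may therefore replace the value.\<close>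

lemma localize:
  assumes g: "g \<in> S" and b: "b \<in> X" and n: "near {x \<in> X. \<not> prefix b x} g id"
  obtains g0 where "g0 \<in> S" "near X g (lift b g0)"
proof -
  obtain C where C: "\<And>x. x \<in> X \<Longrightarrow> \<not> prefix b x \<Longrightarrow> ld (g x) x \<le> C" using n unfolding near_def by auto
  define g0 where "g0 w = (if prefix b (g (b @ w)) then drop (length b) (g (b @ w)) else [])" for w
  have g0X: "g0 w \<in> X" if "w \<in> X" for w
  proof -
    have "g (b @ w) \<in> X" using S_closed[OF g] that b by simp
    then show ?thesis by (auto simp: g0_def elim!: prefixE)
  qed
  obtain D where D: "\<forall>x\<in>X. \<forall>y\<in>X. ld (g x) (g y) \<le> C \<longrightarrow> ld x y \<le> D"
    using qie_lower[OF S_qie[OF g]] by blast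
  define H where "H = lift b g0"
  have HX: "H \<in> X \<rightarrow> X"
    unfolding H_def lift_def
    by (intro funcsetI branch_map_closed g0X) (auto simp: prefix_free_def)
  have nH: "near X g H"
    unfolding near_def
  proof (intro exI ballI)
    fix x assume x: "x \<in> X"
    show "ld (g x) (H x) \<le> \<bar>C\<bar> + \<bar>D\<bar>"
    proof (cases "prefix b x")
      case False
      then show ?thesis using C[OF x] by (simp add: H_def lift_outside)
    next
      case True
      then obtain w where w: "x = b @ w" "w \<in> X" using prefix_in_X x by blast
      show ?thesis
      proof (cases "prefix b (g x)")
        case True
        then show ?thesis by (auto simp: H_def w g0_def elim: prefixE)
      next
        case False
        then have Hx: "H x = b" by (simp add: H_def w g0_def)
        have gx: "g x \<in> X" using S_closed g x by blast
        have "ld (g (g x)) (g x) \<le> C" using C gx False by blast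
        then have "ld x (g x) \<le> D" using D gx x ld_sym by metis
        then have "ld b (g x) \<le> D" using ld_gate[OF False, of w] by (simp add: w)
        then show ?thesis by (simp add: Hx ld_sym)
      qed
    qed
  qed
  have HS: "H \<in> S" using S_near[OF g nH HX] .
  have "g0 \<in> S" unfolding S_iff
  proof (intro conjI)
    show "g0 \<in> X \<rightarrow> X" using g0X by blast
    obtain l K where l: "l \<in> L" "0 \<le> K" and lK: "\<forall>x\<in>X. \<forall>y\<in>X. inverse l * ld x y - K \<le> ld (H x) (H y) \<and>
      ld (H x) (H y) \<le> l * ld x y + K"
      using S_qie[OF HS] unfolding qie_def by blast
    have "inverse l * ld x y - K \<le> ld (g0 x) (g0 y) \<and> ld (g0 x) (g0 y) \<le> l * ld x y + K"
      if "x \<in> X" "y \<in> X" for x y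
      using lK[rule_format, of "b @ x" "b @ y"] that b by (simp add: H_def)
    then show "qie X g0" unfolding qie_def using l by blast
    obtain K where K: "\<And>y. y \<in> X \<Longrightarrow> \<exists>x\<in>X. ld y (H x) \<le> K"
      using HS unfolding S_iff codense_def by blast
    have "\<exists>v\<in>X. ld w (g0 v) \<le> \<bar>K\<bar> + length (g0 [])" if w: "w \<in> X" for w
    proof -
      obtain x where x: "x \<in> X" "ld (b @ w) (H x) \<le> K" using K[of "b @ w"] w b by auto
      show ?thesis
      proof (cases "prefix b x")
        case True
        then obtain v where "x = b @ v" "v \<in> X" using prefix_in_X x by blast
        then show ?thesis using x by (intro bexI[of _ v]) (auto simp: H_def)
      next
        case False
        then have "ld (b @ w) x \<le> K" using x by (simp add: H_def lift_outside)
        then have "length w \<le> K" using ld_gate[OF False, of w] ld_nonneg[of b x] by linarith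
        then show ?thesis by (intro bexI[of _ "[]"]) (auto simp: ld_def)
      qed
    qed
    then show "codense X g0" unfolding codense_def by blast
  qed
  then show thesis using that nH by (simp add: H_def)
qed

end

section \<open>Commutator identities in abstract groups\<close>

lemma (in group) inv_mult_cancel:
  "x \<in> carrier G \<Longrightarrow> z \<in> carrier G \<Longrightarrow> inv x \<otimes> (x \<otimes> z) = z"
  "x \<in> carrier G \<Longrightarrow> z \<in> carrier G \<Longrightarrow> x \<otimes> (inv x \<otimes> z) = z"
  by (simp_all add: m_assoc[symmetric])

text \<open>Since \<open>H\<close> is the conjugate of \<open>F\<close> by \<open>c\<close>, the
  commutator of \<open>F\<close> and \<open>c\<close> is \<open>F \<otimes> inv H\<close>. As
  \<open>H\<close> commutes with \<open>s\<close>, the commutator of this element with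
  \<open>s\<close> equals that of \<open>F\<close> with \<open>s\<close>, which is \<open>g\<close>.
  Expanding instead in terms of \<open>c\<close> gives the four conjugates.\<close>

lemma (in group) double_commutator:
  assumes G: "c \<in> carrier G" "F \<in> carrier G" "H \<in> carrier G" "s \<in> carrier G" "g \<in> carrier G"
    and "c \<otimes> F = H \<otimes> c" "H \<otimes> s = s \<otimes> H" "F \<otimes> s = g \<otimes> s \<otimes> F"
  shows "g = F \<otimes> c \<otimes> inv F \<otimes> (inv c \<otimes> (s \<otimes> c \<otimes> inv s \<otimes>
    ((s \<otimes> F) \<otimes> inv c \<otimes> inv (s \<otimes> F))))"
proof -
  have H: "H = c \<otimes> F \<otimes> inv c" using G by (simp add: assms(6) m_assoc)
  have iH: "inv H \<otimes> s \<otimes> H = s"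
  proof -
    have "inv H \<otimes> s \<otimes> H = inv H \<otimes> (H \<otimes> s)" using G by (simp add: m_assoc assms(7))
    then show ?thesis using G by (simp add: inv_mult_cancel)
  qed
  have g: "g = F \<otimes> s \<otimes> inv F \<otimes> inv s"
  proof -
    have "F \<otimes> s \<otimes> inv F \<otimes> inv s = g"
      using G by (simp only: assms(8)) (simp add: m_assoc inv_mult_cancel)
    then show ?thesis by simp
  qed
  have "F \<otimes> c \<otimes> inv F \<otimes> (inv c \<otimes> (s \<otimes> c \<otimes> inv s \<otimes> ((s \<otimes> F) \<otimes> inv c \<otimes> inv (s \<otimes> F))))
     = F \<otimes> (inv H \<otimes> s \<otimes> H) \<otimes> inv F \<otimes> inv s"
    using G by (simp add: H inv_mult_group m_assoc inv_mult_cancel)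
  then show ?thesis using g iH by simp
qed

lemma (in group) foldr_conj:
  assumes "y \<in> carrier G" "set cs \<subseteq> carrier G"
  shows "foldr (\<otimes>) (map (\<lambda>x. y \<otimes> x \<otimes> inv y) cs) \<one> = y \<otimes> foldr (\<otimes>) cs \<one> \<otimes> inv y"
  using assms(2)
proof (induction cs)
  case Nil
  then show ?case using assms by simp
next
  case (Cons a cs)
  have "foldr (\<otimes>) cs \<one> \<in> carrier G" using Cons(2) by (induction cs) auto
  then show ?case using Cons assms by (simp add: m_assoc inv_mult_cancel)
qed

context words begin

text \<open>The group stays abstract: only a surjection from \<open>S\<close> with
  \<open>near\<close> as its kernel relation is required. The classes of maps of the vertex set can
  then be treated through a coding by words.\<close>

lemma uniformly_simple_image:
  fixes G :: "('g, 'm) monoid_scheme" and h :: "(nat list \<Rightarrow> nat list) \<Rightarrow> 'g"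
  assumes G: "group G" and onto: "h ` S = carrier G"
    and hom: "\<And>f g. f \<in> S \<Longrightarrow> g \<in> S \<Longrightarrow> h (f \<circ> g) = h f \<otimes>\<^bsub>G\<^esub> h g"
    and eq: "\<And>f g. f \<in> S \<Longrightarrow> g \<in> S \<Longrightarrow> h f = h g \<longleftrightarrow> near X f g"
  shows "uniformly_simple 5 G"
proof -
  interpret group G by (rule G)
  have hG: "h f \<in> carrier G" if "f \<in> S" for f using that onto by blast
  have h_id: "h id = \<one>\<^bsub>G\<^esub>"
    using hom[OF S_id S_id] hG[OF S_id] by (metis comp_id l_cancel_one')
  have h_inv: "h f' = inv\<^bsub>G\<^esub> (h f)" if "f \<in> S" "f' \<in> S" "near X (f' \<circ> f) id" for f f'
    using that hom[of f' f] eq[OF S_comp S_id] h_id hG by (metis inv_equality)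
  have letters: "0 < q" "1 < q" using q2 by auto
  have SX: "f \<in> A \<rightarrow> X" if "f \<in> S" "A \<subseteq> X" for f A using that S_closed by blast
  have "\<exists>cs. length cs \<le> 5 \<and> set cs \<subseteq> C \<union> m_inv G ` C \<and> F = foldr (mult G) cs \<one>\<^bsub>G\<^esub>"
    if F: "F \<in> carrier G - {\<one>\<^bsub>G\<^esub>}" and C: "C \<in> conjugacy_classes G - {{\<one>\<^bsub>G\<^esub>}}" for F C
  proof -
    obtain f where f: "f \<in> S" "F = h f" using F onto by auto
    have fn: "\<not> near X f id" using F f eq[OF f(1) S_id] h_id by simp
    obtain c0 where c0: "c0 \<in> carrier G"
      and C_def: "C = {x \<otimes>\<^bsub>G\<^esub> c0 \<otimes>\<^bsub>G\<^esub> inv\<^bsub>G\<^esub> x |x. x \<in> carrier G}"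
      using C unfolding conjugacy_classes_def by blast
    have "c0 \<noteq> \<one>\<^bsub>G\<^esub>"
    proof
      assume "c0 = \<one>\<^bsub>G\<^esub>"
      then have "C = {\<one>\<^bsub>G\<^esub>}" unfolding C_def by (auto intro!: exI[of _ "\<one>\<^bsub>G\<^esub>"])
      with C show False by blast
    qed
    obtain c where c: "c \<in> S" "c0 = h c" using c0 onto by blast
    have cn: "\<not> near X c id" using \<open>c0 \<noteq> _\<close> c eq[OF c(1) S_id] h_id by simp
    have C_carrier: "x \<in> carrier G" if "x \<in> C" for x using that c0 by (auto simp: C_def)
    have C_conj: "y \<otimes>\<^bsub>G\<^esub> x \<otimes>\<^bsub>G\<^esub> inv\<^bsub>G\<^esub> y \<in> C" if "x \<in> C" "y \<in> carrier G" for x y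
    proof -
      obtain z where z: "z \<in> carrier G" "x = z \<otimes>\<^bsub>G\<^esub> c0 \<otimes>\<^bsub>G\<^esub> inv\<^bsub>G\<^esub> z" using \<open>x \<in> C\<close> C_def by blast
      have "y \<otimes>\<^bsub>G\<^esub> x \<otimes>\<^bsub>G\<^esub> inv\<^bsub>G\<^esub> y = (y \<otimes>\<^bsub>G\<^esub> z) \<otimes>\<^bsub>G\<^esub> c0 \<otimes>\<^bsub>G\<^esub> inv\<^bsub>G\<^esub> (y \<otimes>\<^bsub>G\<^esub> z)"
        using z that(2) c0 by (simp add: inv_mult_group m_assoc)
      then show ?thesis using z that(2) unfolding C_def by blast
    qed
    have C_inv_conj: "y \<otimes>\<^bsub>G\<^esub> x \<otimes>\<^bsub>G\<^esub> inv\<^bsub>G\<^esub> y \<in> m_inv G ` C" if "x \<in> m_inv G ` C" "y \<in> carrier G" for x y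
    proof -
      obtain z where z: "z \<in> C" "x = inv\<^bsub>G\<^esub> z" using \<open>x \<in> m_inv G ` C\<close> by blast
      have "y \<otimes>\<^bsub>G\<^esub> x \<otimes>\<^bsub>G\<^esub> inv\<^bsub>G\<^esub> y = inv\<^bsub>G\<^esub> (y \<otimes>\<^bsub>G\<^esub> z \<otimes>\<^bsub>G\<^esub> inv\<^bsub>G\<^esub> y)"
        using z(2) C_carrier[OF z(1)] that(2) by (simp add: inv_mult_group m_assoc)
      then show ?thesis using C_conj[OF z(1) that(2)] by blast
    qed
    have conj_h: "h (k' \<circ> e \<circ> k) = h k' \<otimes>\<^bsub>G\<^esub> h e \<otimes>\<^bsub>G\<^esub> inv\<^bsub>G\<^esub> (h k')"
      if "k \<in> S" "k' \<in> S" "e \<in> S" "near X (k \<circ> k') id" for k k' e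
      using that hom S_comp h_inv[OF that(2,1,4)] by simp

    \<comment> \<open>The word 001 is \<open>pos 0\<close>, so that the quotient will be supported
      where the commutator identity needs it. Its children 0010 and 0011 serve as \<open>p\<close>
      and as the free branch demanded by the normal form.\<close>
    define Q where "Q = {x \<in> X. \<not> prefix [0, 0, 1] x}"
    have Q: "clopen Q"
    proof (rule clopenI[where C = 3])
      fix x y assume "x \<in> Q" "y \<in> X" "y \<notin> Q"
      then obtain w where w: "y = [0, 0, 1] @ w" by (auto simp: Q_def elim: prefixE)
      have "lcp y x = lcp [0, 0, 1] x" unfolding w using \<open>x \<in> Q\<close> by (intro lcp_append_nonprefix) (auto simp: Q_def)
      then show "real (lcp x y) \<le> 3" using lcp_le_left[of "[0, 0, 1]" x] lcp_commute[of x y] by simp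
    qed (auto simp: Q_def)
    have QX: "Q \<subseteq> X" by (auto simp: Q_def)
    obtain t Ct where t: "\<And>y. y \<in> Q \<Longrightarrow> t y \<in> X"
      "\<And>x y. x \<in> Q \<Longrightarrow> y \<in> Q \<Longrightarrow> \<bar>ld (t x) (t y) - ld x y\<bar> \<le> Ct" "codense Q t"
      by (rule swindle_inverse[OF Q, of "[1]"]) (use letters in \<open>auto simp: Q_def\<close>)
    define \<tau> where "\<tau> y = [0, 0, 1, 0] @ t y" for y
    have \<tau>: "\<tau> \<in> Q \<rightarrow> X" using t(1) letters by (auto simp: \<tau>_def)
    have data: "[0, 0, 1, 0] \<in> X" "\<And>y. y \<in> Q \<Longrightarrow> \<not> prefix [0, 0, 1, 0] y" "[0, 0, 1, 1] \<in> X"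
      "\<And>w. w \<in> X \<Longrightarrow> \<not> prefix [0, 0, 1, 0] ([0, 0, 1, 1] @ w) \<and> [0, 0, 1, 1] @ w \<notin> Q"
      using letters by (auto simp: Q_def prefix_def)
    \<comment> \<open>Using the same data for \<open>f\<close> and for \<open>c\<close> makes both
      conjugates undo \<open>\<tau>\<close> up to bounded error.\<close>
    obtain k k' where k: "k \<in> S" "k' \<in> S" "near X (k \<circ> k') id" "near X (k' \<circ> k) id"
      "near Q (\<lambda>y. k' (f (k (\<tau> y)))) id"
      using normal_form[OF f(1) fn data(1) Q data(2) t data(3,4)] unfolding \<tau>_def by metis
    obtain m m' where m: "m \<in> S" "m' \<in> S" "near X (m \<circ> m') id" "near X (m' \<circ> m) id"
      "near Q (\<lambda>y. m' (c (m (\<tau> y)))) id"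
      using normal_form[OF c(1) cn data(1) Q data(2) t data(3,4)] unfolding \<tau>_def by metis
    define f1 where "f1 = k' \<circ> f \<circ> k"
    define c2 where "c2 = m' \<circ> c \<circ> m"
    have f1: "f1 \<in> S" "near Q (\<lambda>y. f1 (\<tau> y)) id" using k f S_comp by (auto simp: f1_def)
    have c2: "c2 \<in> S" "near Q (\<lambda>y. c2 (\<tau> y)) id" using m c S_comp by (auto simp: c2_def)
    obtain d where d: "d \<in> S" "near X (c2 \<circ> d) id" "near X (d \<circ> c2) id" using S_inverse[OF c2(1)] by blast
    define g where "g = f1 \<circ> d"
    have g: "g \<in> S" using f1 d S_comp by (simp add: g_def)
    have "near Q g id"
    proof -
      have 1: "near Q (\<lambda>y. d (c2 (\<tau> y))) d"
        using near_comp_left[OF c2(2) d(1)] SX c2(1) \<tau> QX S_closed by (force simp: Pi_iff)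
      have 2: "near Q (\<lambda>y. d (c2 (\<tau> y))) \<tau>"
        using near_comp_right[OF d(3) \<tau>] by simp
      have cl: "(\<lambda>y. d (c2 (\<tau> y))) \<in> Q \<rightarrow> X" "d \<in> Q \<rightarrow> X" "(\<lambda>y. f1 (d y)) \<in> Q \<rightarrow> X" "(\<lambda>y. f1 (\<tau> y)) \<in> Q \<rightarrow> X"
        "id \<in> Q \<rightarrow> X"
        using \<tau> QX S_closed[OF d(1)] S_closed[OF c2(1)] S_closed[OF f1(1)]
        by (auto dest: funcset_mem)
      \<comment> \<open>On \<open>Q\<close> the coarse inverse of \<open>c2\<close> is
        \<open>\<tau>\<close>, which \<open>f1\<close> then undoes.\<close>
      have "near Q d \<tau>"
        by (rule near_trans[OF near_sym[OF 1 cl(1,2)] 2 cl(2,1) \<tau>])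
      then have "near Q (\<lambda>y. f1 (d y)) (\<lambda>y. f1 (\<tau> y))"
        by (rule near_comp_left[OF _ f1(1) cl(2) \<tau>])
      from near_trans[OF this f1(2) cl(3,4,5)] show ?thesis by (simp add: g_def comp_def)
    qed
    then obtain g0 where g0: "g0 \<in> S" "near X g (lift [0, 0, 1] g0)"
      using localize[OF g, of "[0, 0, 1]"] letters by (auto simp: Q_def)

    \<comment> \<open>The normal form is used again, now with the map deleting two letters: a
      conjugate of \<open>c\<close> sends \<open>[0, 0] @ w\<close> near \<open>[0, 1] @ w\<close>,
      where \<open>shift\<close> is trivial.\<close>
    define Q' where "Q' = {x \<in> X. prefix [0, 1] x}"
    have Q': "clopen Q'" unfolding Q'_def by (rule clopen_branch) (use letters in simp)
    have t': "drop 2 y \<in> X" if "y \<in> Q'" for y using that by (auto simp: Q'_def elim: prefixE)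
    have t'': "\<bar>ld (drop 2 x) (drop 2 y) - ld x y\<bar> \<le> 0" if "x \<in> Q'" "y \<in> Q'" for x y
      using that by (auto simp: Q'_def elim!: prefixE)
    have "\<exists>x\<in>Q'. ld y (drop 2 x) \<le> 0" if "y \<in> X" for y
      using that letters by (intro bexI[of _ "[0, 1] @ y"]) (auto simp: Q'_def)
    then have t''': "codense Q' (drop 2)" unfolding codense_def by blast
    have data': "[0, 0] \<in> X" "\<And>y. y \<in> Q' \<Longrightarrow> \<not> prefix [0, 0] y" "[1] \<in> X"
      "\<And>w. w \<in> X \<Longrightarrow> \<not> prefix [0, 0] ([1] @ w) \<and> [1] @ w \<notin> Q'"
      using letters by (auto simp: Q'_def prefix_def)
    obtain n n' where n: "n \<in> S" "n' \<in> S" "near X (n \<circ> n') id" "near X (n' \<circ> n) id"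
      "near Q' (\<lambda>y. n' (c (n ([0, 0] @ drop 2 y)))) id"
      using normal_form[OF c(1) cn data'(1) Q' data'(2) t' t'' t''' data'(3,4)] by metis
    define c3 where "c3 = n' \<circ> c \<circ> n"
    have c3: "c3 \<in> S" using n c S_comp by (simp add: c3_def)
    have "near X (\<lambda>w. c3 ([0, 0] @ w)) (\<lambda>w. [0, 1] @ w)"
    proof -
      have "(\<lambda>w. [0, 1] @ w) \<in> X \<rightarrow> Q'" using letters by (auto simp: Q'_def)
      from near_comp_right[OF n(5) this] show ?thesis by (simp add: c3_def)
    qed
    note tw = intertwine[OF c3 spread_S[OF g0(1)] _ _ this]
    define FF where "FF = lift [0, 0] (spread g0)"
    define H where "H = lift [0, 1] (spread g0)"
    define gg where "gg = lift [0, 0, 1] g0"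
    have FF: "FF \<in> S" and H: "H \<in> S" and gg: "gg \<in> S"
      using letters by (auto simp: FF_def H_def gg_def intro!: lift_S spread_S g0)
    have r1: "h c3 \<otimes>\<^bsub>G\<^esub> h FF = h H \<otimes>\<^bsub>G\<^esub> h c3"
      using tw letters c3 FF H eq[OF S_comp S_comp] by (simp add: FF_def H_def flip: hom)
    have r2: "h H \<otimes>\<^bsub>G\<^esub> h shift = h shift \<otimes>\<^bsub>G\<^esub> h H"
      using lift_shift_commute[of "spread g0"] H shift_S by (simp add: H_def flip: hom)
    have r3: "h FF \<otimes>\<^bsub>G\<^esub> h shift = h gg \<otimes>\<^bsub>G\<^esub> h shift \<otimes>\<^bsub>G\<^esub> h FF"
      using commutator_identity[of g0] FF gg shift_S S_comp by (simp add: FF_def gg_def flip: hom)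
    define a where "a = h c3"
    define u where "u = h FF"
    define v where "v = h shift"
    have car: "a \<in> carrier G" "u \<in> carrier G" "v \<in> carrier G" "h gg \<in> carrier G" "h c2 \<in> carrier G"
      using hG c3 FF shift_S gg c2 by (auto simp: a_def u_def v_def)
    have aC: "a \<in> C"
      using conj_h[OF n(1,2) c(1) n(3)] hG[OF n(2)] by (auto simp: a_def c3_def C_def c)
    have c2C: "h c2 \<in> C"
      using conj_h[OF m(1,2) c(1) m(3)] hG[OF m(2)] by (auto simp: c2_def C_def c)
    have gg4: "h gg = u \<otimes>\<^bsub>G\<^esub> a \<otimes>\<^bsub>G\<^esub> inv\<^bsub>G\<^esub> u \<otimes>\<^bsub>G\<^esub> (inv\<^bsub>G\<^esub> a \<otimes>\<^bsub>G\<^esub> (v \<otimes>\<^bsub>G\<^esub> a \<otimes>\<^bsub>G\<^esub> inv\<^bsub>G\<^esub> v \<otimes>\<^bsub>G\<^esub>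
      ((v \<otimes>\<^bsub>G\<^esub> u) \<otimes>\<^bsub>G\<^esub> inv\<^bsub>G\<^esub> a \<otimes>\<^bsub>G\<^esub> inv\<^bsub>G\<^esub> (v \<otimes>\<^bsub>G\<^esub> u))))"
      unfolding a_def u_def v_def
      by (rule double_commutator[OF hG[OF c3] hG[OF FF] hG[OF H] hG[OF shift_S] hG[OF gg] r1 r2 r3])
    \<comment> \<open>Four factors give \<open>h gg\<close>, and the fifth restores
      \<open>h f1\<close> from the quotient.\<close>
    define cs where "cs = [u \<otimes>\<^bsub>G\<^esub> a \<otimes>\<^bsub>G\<^esub> inv\<^bsub>G\<^esub> u, inv\<^bsub>G\<^esub> a, v \<otimes>\<^bsub>G\<^esub> a \<otimes>\<^bsub>G\<^esub> inv\<^bsub>G\<^esub> v,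
      (v \<otimes>\<^bsub>G\<^esub> u) \<otimes>\<^bsub>G\<^esub> inv\<^bsub>G\<^esub> a \<otimes>\<^bsub>G\<^esub> inv\<^bsub>G\<^esub> (v \<otimes>\<^bsub>G\<^esub> u), h c2]"
    have cs: "set cs \<subseteq> C \<union> m_inv G ` C"
      using C_conj[OF aC] C_inv_conj[of "inv\<^bsub>G\<^esub> a" "v \<otimes>\<^bsub>G\<^esub> u"] aC c2C car by (auto simp: cs_def)
    then have csG: "set cs \<subseteq> carrier G" using C_carrier by auto
    have "h f1 = h gg \<otimes>\<^bsub>G\<^esub> h c2"
    proof -
      have "h gg = h g" using eq[OF g gg] g0(2) by (simp add: gg_def)
      also have "\<dots> = h f1 \<otimes>\<^bsub>G\<^esub> inv\<^bsub>G\<^esub> (h c2)"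
        using hom[OF f1(1) d(1)] h_inv[OF c2(1) d(1,3)] by (simp add: g_def)
      finally show ?thesis using car hG[OF f1(1)] by (simp add: m_assoc)
    qed
    also have "\<dots> = foldr (mult G) cs \<one>\<^bsub>G\<^esub>"
      using car by (simp add: gg4 cs_def m_assoc)
    finally have f1cs: "h f1 = foldr (mult G) cs \<one>\<^bsub>G\<^esub>" .
    \<comment> \<open>Conjugating every factor back by \<open>k\<close> turns the product for
      \<open>f1\<close> into one for \<open>f\<close> and keeps each factor in the class or among
      the inverses.\<close>
    define y where "y = h k"
    have y: "y \<in> carrier G" using hG k by (simp add: y_def)
    have "h f1 = inv\<^bsub>G\<^esub> y \<otimes>\<^bsub>G\<^esub> F \<otimes>\<^bsub>G\<^esub> y"
      using conj_h[OF k(1,2) f(1) k(3)] h_inv[OF k(1,2,4)] y by (simp add: f1_def y_def f(2))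
    then have "F = y \<otimes>\<^bsub>G\<^esub> foldr (mult G) cs \<one>\<^bsub>G\<^esub> \<otimes>\<^bsub>G\<^esub> inv\<^bsub>G\<^esub> y"
      using y F by (simp add: m_assoc inv_mult_cancel flip: f1cs)
    then have "F = foldr (mult G) (map (\<lambda>x. y \<otimes>\<^bsub>G\<^esub> x \<otimes>\<^bsub>G\<^esub> inv\<^bsub>G\<^esub> y) cs) \<one>\<^bsub>G\<^esub>"
      using foldr_conj[OF y csG] by simp
    moreover have "set (map (\<lambda>x. y \<otimes>\<^bsub>G\<^esub> x \<otimes>\<^bsub>G\<^esub> inv\<^bsub>G\<^esub> y) cs) \<subseteq> C \<union> m_inv G ` C"
      using cs C_conj[OF _ y] C_inv_conj[OF _ y] by auto
    moreover have "length (map (\<lambda>x. y \<otimes>\<^bsub>G\<^esub> x \<otimes>\<^bsub>G\<^esub> inv\<^bsub>G\<^esub> y) cs) \<le> 5" by (simp add: cs_def)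
    ultimately show ?thesis by blast
  qed
  then show ?thesis unfolding uniformly_simple_def using G by blast
qed

end

section \<open>Change of the model\<close>

text \<open>The change of model distorts distances only additively, so the multiplicative constant
  of \<open>f\<close> is kept; for \<open>L\<close> equal to \<open>{1}\<close> this is
  indispensable. The bound for \<open>\<psi>\<close> follows from that for
  \<open>\<phi>\<close>.\<close>

lemma S_conjugate:
  assumes V: "coarse_space L V d" and V': "coarse_space L V' d'"
    and phi: "\<And>u. u \<in> V \<Longrightarrow> \<phi> u \<in> V'" and psi: "\<And>x. x \<in> V' \<Longrightarrow> \<psi> x \<in> V"
    and inv: "\<And>x. x \<in> V' \<Longrightarrow> \<phi> (\<psi> x) = x"
    and C: "\<And>u v. u \<in> V \<Longrightarrow> v \<in> V \<Longrightarrow> \<bar>d' (\<phi> u) (\<phi> v) - d u v\<bar> \<le> C"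
    and f: "f \<in> coarse_space.S L V' d'"
  shows "\<psi> \<circ> f \<circ> \<phi> \<in> coarse_space.S L V d"
proof -
  interpret A: coarse_space L V d by (rule V)
  interpret B: coarse_space L V' d' by (rule V')
  have fc: "f x \<in> V'" if "x \<in> V'" for x using B.S_closed f that by blast
  have C': "\<bar>d (\<psi> x) (\<psi> y) - d' x y\<bar> \<le> C" if "x \<in> V'" "y \<in> V'" for x y
    using C[of "\<psi> x" "\<psi> y"] psi inv that by (simp add: abs_minus_commute)
  obtain l K where l: "l \<in> L" "0 \<le> K" and lK: "\<And>x y. x \<in> V' \<Longrightarrow> y \<in> V' \<Longrightarrow>
     inverse l * d' x y - K \<le> d' (f x) (f y) \<and> d' (f x) (f y) \<le> l * d' x y + K"
    using B.S_qie[OF f] unfolding B.qie_def by blast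
  have l1: "1 \<le> l" using A.ge_one l by blast
  have "A.qie V (\<psi> \<circ> f \<circ> \<phi>)"
    unfolding A.qie_def
  proof (intro bexI[OF _ l(1)] exI[of _ "K + \<bar>C\<bar> + l * \<bar>C\<bar>"] conjI ballI)
    show "0 \<le> K + \<bar>C\<bar> + l * \<bar>C\<bar>" using l l1 by simp
    fix u v assume uv: "u \<in> V" "v \<in> V"
    note 1 = C[OF uv] and 2 = C'[OF fc[OF phi[OF uv(1)]] fc[OF phi[OF uv(2)]]]
      and 3 = lK[OF phi[OF uv(1)] phi[OF uv(2)]]
    have "d' (\<phi> u) (\<phi> v) \<le> d u v + \<bar>C\<bar>" "d u v - \<bar>C\<bar> \<le> d' (\<phi> u) (\<phi> v)" using 1 by auto
    then have "l * d' (\<phi> u) (\<phi> v) \<le> l * d u v + l * \<bar>C\<bar>"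
      "inverse l * d u v - inverse l * \<bar>C\<bar> \<le> inverse l * d' (\<phi> u) (\<phi> v)"
      using l1 mult_left_mono[of "d' (\<phi> u) (\<phi> v)" "d u v + \<bar>C\<bar>" l]
        mult_left_mono[of "d u v - \<bar>C\<bar>" "d' (\<phi> u) (\<phi> v)" "inverse l"] by (simp_all add: algebra_simps)
    moreover have "inverse l * \<bar>C\<bar> \<le> l * \<bar>C\<bar>"
      using l1 by (intro mult_right_mono) (auto simp: field_simps intro: order_trans[of 1 l "l * l"])
    ultimately show "inverse l * d u v - (K + \<bar>C\<bar> + l * \<bar>C\<bar>) \<le> d ((\<psi> \<circ> f \<circ> \<phi>) u) ((\<psi> \<circ> f \<circ> \<phi>) v)"
      "d ((\<psi> \<circ> f \<circ> \<phi>) u) ((\<psi> \<circ> f \<circ> \<phi>) v) \<le> l * d u v + (K + \<bar>C\<bar> + l * \<bar>C\<bar>)"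
      using 2 3 unfolding comp_def by linarith+
  qed
  moreover have "A.codense V (\<psi> \<circ> f \<circ> \<phi>)"
  proof -
    obtain K where K: "\<And>y. y \<in> V' \<Longrightarrow> \<exists>x\<in>V'. d' y (f x) \<le> K"
      using f unfolding B.S_iff B.codense_def by blast
    have "\<exists>x\<in>V. d y ((\<psi> \<circ> f \<circ> \<phi>) x) \<le> K + C" if y: "y \<in> V" for y
    proof -
      obtain x where x: "x \<in> V'" "d' (\<phi> y) (f x) \<le> K" using K[OF phi[OF y]] by blast
      have "d y (\<psi> (f x)) \<le> K + C"
        using C[OF y psi[OF fc[OF x(1)]]] inv[OF fc[OF x(1)]] x(2) by simp
      then show ?thesis using x psi inv by (intro bexI[of _ "\<psi> x"]) auto
    qed
    then show ?thesis unfolding A.codense_def by blast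
  qed
  ultimately show ?thesis using phi psi fc by (auto simp: A.S_iff)
qed

lemma (in words) uniformly_simple_transfer:
  assumes V: "coarse_space L V d"
    and bij: "bij_betw \<phi> V X"
    and C: "\<And>u v. u \<in> V \<Longrightarrow> v \<in> V \<Longrightarrow> \<bar>ld (\<phi> u) (\<phi> v) - d u v\<bar> \<le> C"
  shows "uniformly_simple 5 (maps_mod_bounded V d (coarse_space.S L V d))"
proof -
  interpret A: coarse_space L V d by (rule V)
  define \<psi> where "\<psi> = inv_into V \<phi>"
  have phi: "\<phi> u \<in> X" if "u \<in> V" for u using bij that by (auto simp: bij_betw_def)
  have psi: "\<psi> x \<in> V" "\<phi> (\<psi> x) = x" if "x \<in> X" for x
    using that bij by (auto simp: \<psi>_def bij_betw_def inv_into_into f_inv_into_f)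
  have psi': "\<psi> (\<phi> u) = u" if "u \<in> V" for u using that bij by (simp add: \<psi>_def bij_betw_def)
  have C': "\<bar>d (\<psi> x) (\<psi> y) - ld x y\<bar> \<le> C" if "x \<in> X" "y \<in> X" for x y
    using C[of "\<psi> x" "\<psi> y"] psi that by (simp add: abs_minus_commute)
  have push: "\<psi> \<circ> f \<circ> \<phi> \<in> A.S" if "f \<in> S" for f
    by (rule S_conjugate[OF V coarse_space_axioms phi psi(1,2) C that])
  have pull: "\<phi> \<circ> f \<circ> \<psi> \<in> S" if "f \<in> A.S" for f
    by (rule S_conjugate[OF coarse_space_axioms V psi(1) phi psi' C' that])
  define h where "h f = A.cl (\<psi> \<circ> f \<circ> \<phi>)" for f
  have eqI: "A.cl f = A.cl g" if "f \<in> A.S" "g \<in> A.S" "\<And>u. u \<in> V \<Longrightarrow> f u = g u" for f g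
  proof -
    have "A.near V f g" unfolding A.near_def
      using that A.d_self A.S_closed by (intro exI[of _ 0]) auto
    then show ?thesis using that A.cl_eq_iff by blast
  qed
  show ?thesis
  proof (rule uniformly_simple_image[of _ h])
    show "group A.G" by (rule A.group_G)
    show "h ` S = carrier A.G"
    proof -
      have "A.cl g \<in> h ` S" if g: "g \<in> A.S" for g
      proof (rule image_eqI)
        show "\<phi> \<circ> g \<circ> \<psi> \<in> S" using pull g .
        show "A.cl g = h (\<phi> \<circ> g \<circ> \<psi>)" unfolding h_def
          by (rule eqI[OF g push[OF pull[OF g]]]) (simp add: psi' A.S_closed[OF g])
      qed
      then show ?thesis using push by (auto simp: A.carrier_G h_def)
    qed
    fix f g assume fg: "f \<in> S" "g \<in> S"
    show "h (f \<circ> g) = h f \<otimes>\<^bsub>A.G\<^esub> h g"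
      unfolding h_def A.mult_G[OF push[OF fg(1)] push[OF fg(2)]]
      by (rule eqI[OF push[OF S_comp[OF fg]] A.S_comp[OF push[OF fg(1)] push[OF fg(2)]]])
        (use psi S_closed[OF fg(2)] phi in simp)
    show "(h f = h g) = near X f g"
      unfolding h_def A.cl_eq_iff[OF push[OF fg(1)] push[OF fg(2)]]
    proof
      have *: "\<bar>d (\<psi> (f x)) (\<psi> (g x)) - ld (f x) (g x)\<bar> \<le> C" if "x \<in> X" for x
        by (rule C'[OF S_closed[OF fg(1) that] S_closed[OF fg(2) that]])
      {
        assume "A.near V (\<psi> \<circ> f \<circ> \<phi>) (\<psi> \<circ> g \<circ> \<phi>)"
        then obtain B where B: "\<And>u. u \<in> V \<Longrightarrow> d (\<psi> (f (\<phi> u))) (\<psi> (g (\<phi> u))) \<le> B"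
          unfolding A.near_def by auto
        have "ld (f x) (g x) \<le> B + C" if x: "x \<in> X" for x
          using *[OF x] B[OF psi(1)[OF x]] psi(2)[OF x] by simp
        then show "near X f g" unfolding near_def by blast
      }
      assume "near X f g"
      then obtain B where B: "\<And>x. x \<in> X \<Longrightarrow> ld (f x) (g x) \<le> B" unfolding near_def by auto
      have "d (\<psi> (f (\<phi> u))) (\<psi> (g (\<phi> u))) \<le> B + C" if u: "u \<in> V" for u
        using *[OF phi[OF u]] B[OF phi[OF u]] by simp
      then show "A.near V (\<psi> \<circ> f \<circ> \<phi>) (\<psi> \<circ> g \<circ> \<phi>)" unfolding A.near_def by auto
    qed
  qed
qed

text \<open>The root of the tree has \<open>q + 1\<close> neighbours and every other vertex has \<open>q\<close> children, hence
  only the first letter may be \<open>q\<close>.\<close>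

definition tree_words :: "nat \<Rightarrow> nat list set" where
  "tree_words q = lists {..<q} \<union> (#) q ` lists {..<q}"

lemma Nil_tree_words: "[] \<in> tree_words q"
  by (simp add: tree_words_def)

lemma take_tree_words: "u \<in> tree_words q \<Longrightarrow> take n u \<in> tree_words q"
  by (cases n) (auto simp: tree_words_def take_in_lists)

lemma snoc_tree_words:
  "u @ [i] \<in> tree_words q \<longleftrightarrow> u \<in> tree_words q \<and> (if u = [] then i \<le> q else i < q)"
  by (cases u) (auto simp: tree_words_def Cons_eq_append_conv append_eq_Cons_conv)

text \<open>Hilbert's hotel again: the branch \<open>q\<close> is inserted in front of the branches \<open>0\<^sup>n 1\<close>.\<close>

lemma (in words) tree_words_almost_isometry:
  obtains f where "bij_betw f (tree_words q) X"
    "\<And>x y. \<bar>ld (f x) (f y) - ld x y\<bar> \<le> 6"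
proof -
  \<comment> \<open>The branch \<open>[q]\<close> is the newcomer with index 0. As
    \<open>b n\<close> goes to \<open>zeros_one n\<close>, every older branch advances by one
    place.\<close>
  define b where "b n = (case n of 0 \<Rightarrow> [q] | Suc n \<Rightarrow> zeros_one n)" for n
  have q: "q \<noteq> 0" "q \<noteq> 1" "0 < q" "1 < q" using q2 by auto
  have zq: "\<not> prefix [q] (zeros_one n @ w)" "\<not> prefix (zeros_one n) (q # w)" for n w
    using q by (cases n; simp add: zeros_one_def)+
  have pf: "prefix_free UNIV b"
    unfolding prefix_free_def
  proof (intro ballI impI)
    fix i j assume "prefix (b i) (b j)"
    then show "i = j"
      using zq(1)[of _ "[]"] zq(2)[of _ "[]"] prefix_free_zeros_one
      by (auto simp: b_def prefix_free_def split: nat.splits)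
  qed
  have disp: "\<forall>n\<in>UNIV. ld (b n) (zeros_one n) \<le> 3"
  proof
    fix n
    show "ld (b n) (zeros_one n) \<le> 3"
    proof (cases n)
      case 0
      then show ?thesis using q by (simp add: b_def zeros_one_def ld_def)
    next
      case (Suc m)
      then show ?thesis by (simp add: b_def ld_zeros_one)
    qed
  qed
  have cover: "\<forall>i\<in>UNIV. \<forall>y. prefix (zeros_one i) y \<longrightarrow> (\<exists>j\<in>UNIV. prefix (b j) y)"
    by (intro ballI allI impI) (metis UNIV_I b_def nat.case(2))
  define f where "f = branch_map UNIV b zeros_one id"
  define g where "g = branch_map UNIV zeros_one b id"
  have fb: "f (b n @ w) = zeros_one n @ w" and gb: "g (zeros_one n @ w) = b n @ w" for n w
    by (simp_all add: f_def g_def branch_map_branch[OF pf] branch_map_branch[OF prefix_free_zeros_one])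
  have fo: "f x = x" if "\<not> (\<exists>n. prefix (b n) x)" for x
    using that by (simp add: f_def branch_map_outside)
  have go: "g x = x" if "\<not> (\<exists>n. prefix (zeros_one n) x)" for x
    using that by (simp add: g_def branch_map_outside)
  have b_cases: "prefix [q] x \<or> (\<exists>n. prefix (zeros_one n) x)" if "prefix (b n) x" for n x
    using that by (cases n) (auto simp: b_def)
  show thesis
  proof (rule that[of f])
    show "bij_betw f (tree_words q) X"
    proof (rule bij_betw_byWitness[where f' = g])
      show "\<forall>x\<in>tree_words q. g (f x) = x"
      proof
        fix x
        show "g (f x) = x"
        proof (cases "\<exists>n. prefix (b n) x")
          case True
          then show ?thesis by (auto simp: fb gb elim!: prefixE)
        next
          case False
          then have "\<not> (\<exists>n. prefix (zeros_one n) x)" using cover by blast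
          then show ?thesis using False by (simp add: fo go)
        qed
      qed
      show "\<forall>x\<in>X. f (g x) = x"
      proof
        fix x assume x: "x \<in> X"
        show "f (g x) = x"
        proof (cases "\<exists>n. prefix (zeros_one n) x")
          case True
          then show ?thesis by (auto simp: fb gb elim!: prefixE)
        next
          case False
          moreover have "\<not> prefix [q] x" using x by (auto elim!: prefixE)
          ultimately have "\<not> (\<exists>n. prefix (b n) x)" using b_cases by blast
          then show ?thesis using False by (simp add: fo go)
        qed
      qed
      show "f ` tree_words q \<subseteq> X"
      proof clarify
        fix x assume x: "x \<in> tree_words q"
        show "f x \<in> X"
        proof (cases "\<exists>n. prefix (b n) x")
          case True
          then obtain n w where w: "x = b n @ w" by (auto elim: prefixE)
          have "w \<in> X"
          proof (cases n)
            case 0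
            then show ?thesis using x by (auto simp: w b_def tree_words_def)
          next
            case (Suc m)
            then have "x = zeros_one m @ w" by (simp add: w b_def)
            then have "x \<in> X" using x zq(1)[of m w] by (auto simp: tree_words_def)
            then show ?thesis by (simp add: w)
          qed
          then show ?thesis using zeros_one_X by (simp add: w fb)
        next
          case False
          have "b 0 = [q]" by (simp add: b_def)
          with False have "\<not> prefix [q] x" by metis
          then have "x \<in> X" using x by (auto simp: tree_words_def)
          then show ?thesis using False by (simp add: fo)
        qed
      qed
      show "g ` X \<subseteq> tree_words q"
      proof clarify
        fix x assume x: "x \<in> X"
        show "g x \<in> tree_words q"
        proof (cases "\<exists>n. prefix (zeros_one n) x")
          case True
          then obtain n w where w: "x = zeros_one n @ w" by (auto elim: prefixE)
          then show ?thesis using x zeros_one_X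
            by (cases n) (auto simp: gb b_def tree_words_def)
        next
          case False
          then show ?thesis using x by (simp add: go tree_words_def)
        qed
      qed
    qed
    fix x y
    show "\<bar>ld (f x) (f y) - ld x y\<bar> \<le> 6"
      using branch_map_almost_isometry[OF pf prefix_free_zeros_one cover disp] by (simp add: f_def)
  qed
qed

section \<open>Coding a regular tree by words\<close>

lemma ld_eq_1D:
  assumes "ld u v = 1"
  shows "(\<exists>i. v = u @ [i]) \<or> (\<exists>i. u = v @ [i])"
proof -
  have *: "\<exists>i. v = u @ [i]" if uv: "lcp u v = length u" "length v = Suc (length u)" for u v :: "'a list"
  proof -
    obtain w where w: "v = u @ w" using uv(1) lcp_eq_length_iff[of u v] by (auto elim: prefixE)
    then have "length w = Suc 0" using uv(2) by simp
    then show ?thesis using w by (auto simp: length_Suc_conv)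
  qed
  have "real (length u + length v) = real (1 + 2 * lcp u v)" using assms by (simp add: ld_def)
  then have "length u + length v = 1 + 2 * lcp u v" by (simp only: of_nat_eq_iff)
  then have "lcp u v = length u \<and> length v = Suc (length u) \<or> lcp v u = length v \<and> length u = Suc (length v)"
    using lcp_le_left[of u v] lcp_le_right[of u v] lcp_commute[of u v] by arith
  then show ?thesis using *[of u v] *[of v u] by blast
qed

lemma geodesic_exists:
  assumes "u \<in> W" "v \<in> W" and W: "\<And>u n. u \<in> W \<Longrightarrow> take n u \<in> W" and "ld u v = real n"
  shows "\<exists>y. y 0 = u \<and> y n = v \<and> (\<forall>i\<le>n. y i \<in> W) \<and> (\<forall>i<n. ld (y i) (y (Suc i)) = 1)"
  using assms(1,4)
proof (induction n arbitrary: u)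
  case 0
  then show ?case using assms(2) by (intro exI[of _ "\<lambda>_. u"]) auto
next
  case (Suc n)
  then have "u \<noteq> v" by auto
  then obtain u' where u': "(\<exists>n. u' = take n u) \<or> (\<exists>n. u' = take n v)" "ld u u' = 1" "ld u' v = ld u v - 1"
    by (rule next_vertex)
  have "u' \<in> W" using u'(1) W Suc(2) assms(2) by blast
  then obtain y where y: "y 0 = u'" "y n = v" "\<forall>i\<le>n. y i \<in> W" "\<forall>i<n. ld (y i) (y (Suc i)) = 1"
    using Suc.IH[of u'] Suc.prems(2) u'(3) by auto
  show ?case
    using y u'(2) Suc(2)
    by (intro exI[of _ "\<lambda>i. case i of 0 \<Rightarrow> u | Suc i \<Rightarrow> y i"]) (auto split: nat.splits)
qed

lemma ld_chain:
  assumes "\<forall>i<n. ld (y i) (y (Suc i)) = 1" "i \<le> j" "j \<le> n"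
  shows "ld (y i) (y j) \<le> real (j - i)"
  using assms(2,3)
proof (induction j)
  case (Suc j)
  show ?case
  proof (cases "i = Suc j")
    case False
    then have "ld (y i) (y j) \<le> real (j - i)" "ld (y j) (y (Suc j)) = 1" using Suc assms(1) by auto
    moreover have "real (Suc j - i) = real (j - i) + 1" using Suc False by (simp add: Suc_diff_le)
    ultimately show ?thesis using ld_tri[of "y i" "y (Suc j)" "y j"] by simp
  qed simp
qed simp

locale rooted_regular_tree =
  fixes q :: nat and V :: "'v set" and E :: "'v \<Rightarrow> 'v \<Rightarrow> bool" and root :: 'v
  assumes tree: "regular_tree q V E" and root: "root \<in> V"
begin

abbreviation "W \<equiv> tree_words q"

definition nbrs :: "'v \<Rightarrow> 'v set" where
  "nbrs v = {w \<in> V. E v w}"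

text \<open>Numbers the neighbours outside \<open>P\<close>; with the parent in \<open>P\<close>,
  decoding never turns back.\<close>

definition pick :: "'v \<Rightarrow> 'v set \<Rightarrow> nat \<Rightarrow> 'v" where
  "pick v P = (SOME f. bij_betw f {0..<card (nbrs v - P)} (nbrs v - P))"

text \<open>Reversal puts the latest letters first, so that the recursion reaches both the current
  vertex and its parent.\<close>

fun dec_rev :: "nat list \<Rightarrow> 'v" where
  "dec_rev [] = root"
| "dec_rev [i] = pick root {} i"
| "dec_rev (j # i # u) = pick (dec_rev (i # u)) {dec_rev u} j"

definition dec :: "nat list \<Rightarrow> 'v" where
  "dec u = dec_rev (rev u)"

text \<open>A set instead of a vertex, because the root has no parent.\<close>

definition parents :: "nat list \<Rightarrow> 'v set" where
  "parents u = (if u = [] then {} else {dec (butlast u)})"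

lemma dec_Nil: "dec [] = root"
  by (simp add: dec_def)

lemma dec_snoc: "dec (u @ [j]) = pick (dec u) (parents u) j"
  by (cases u rule: rev_cases) (auto simp: dec_def parents_def)

lemma graph: "simple_graph V E"
  using tree by (simp add: regular_tree_def is_tree_def)

lemma E_in: "E u v \<Longrightarrow> u \<in> V" "E u v \<Longrightarrow> v \<in> V" and E_sym: "E u v \<Longrightarrow> E v u" and E_irrefl: "\<not> E u u"
  using graph by (blast dest: sympD irreflpD simple_graph_def[THEN iffD1])+

lemma card_nbrs: "v \<in> V \<Longrightarrow> card (nbrs v) = q + 1"
  using tree by (simp add: regular_tree_def nbrs_def)

lemma finite_nbrs: "v \<in> V \<Longrightarrow> finite (nbrs v)"
  using card_nbrs[of v] by (intro card_ge_0_finite) simp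

lemma pick_bij: "v \<in> V \<Longrightarrow> bij_betw (pick v P) {0..<card (nbrs v - P)} (nbrs v - P)"
  unfolding pick_def by (rule someI_ex[OF ex_bij_betw_nat_finite]) (simp add: finite_nbrs)

text \<open>There are \<open>q + 1\<close> admissible letters at the root and \<open>q\<close>
  elsewhere, exactly as many as neighbours other than the parent.\<close>

lemma dec_children:
  assumes "u \<in> W"
  shows "dec u \<in> V \<and> parents u \<subseteq> nbrs (dec u) \<and>
    bij_betw (\<lambda>i. dec (u @ [i])) {i. u @ [i] \<in> W} (nbrs (dec u) - parents u)"
  using assms
proof (induction u rule: rev_induct)
  case Nil
  have "{i. [] @ [i] \<in> W} = {0..<card (nbrs root - {})}"
    using card_nbrs[OF root] by (auto simp: tree_words_def)
  then show ?case using pick_bij[OF root, of "{}"] root dec_snoc[of "[]"]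
    by (simp add: dec_Nil parents_def)
next
  case (snoc i u)
  have u: "u \<in> W" "i \<in> {i. u @ [i] \<in> W}" using snoc(2) by (auto simp: snoc_tree_words)
  then have bij: "bij_betw (\<lambda>i. dec (u @ [i])) {i. u @ [i] \<in> W} (nbrs (dec u) - parents u)"
    using snoc by blast
  have "dec (u @ [i]) \<in> nbrs (dec u)" using bij_betwE[OF bij] u(2) by blast
  then have V: "dec (u @ [i]) \<in> V" and sub: "{dec u} \<subseteq> nbrs (dec (u @ [i]))"
    by (auto simp: nbrs_def intro: E_sym E_in)
  have par: "parents (u @ [i]) = {dec u}" by (simp add: parents_def)
  have "{j. (u @ [i]) @ [j] \<in> W} = {0..<card (nbrs (dec (u @ [i])) - {dec u})}"
    using snoc(2) snoc_tree_words[of "u @ [i]"] card_nbrs[OF V] sub by (auto simp: card_Diff_singleton)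
  then show ?case
    using V sub pick_bij[OF V, of "{dec u}"] dec_snoc[of "u @ [i]"] by (simp add: par)
qed

lemma dec_V: "u \<in> W \<Longrightarrow> dec u \<in> V"
  using dec_children by blast

lemma dec_child_edge: "u @ [i] \<in> W \<Longrightarrow> E (dec u) (dec (u @ [i]))"
  using dec_children[of u] bij_betwE[of "\<lambda>i. dec (u @ [i])"] by (fastforce simp: nbrs_def snoc_tree_words)

lemma dec_child_inj: "u @ [i] \<in> W \<Longrightarrow> u @ [j] \<in> W \<Longrightarrow> dec (u @ [i]) = dec (u @ [j]) \<Longrightarrow> i = j"
  using dec_children[of u] by (auto simp: bij_betw_def inj_on_def snoc_tree_words)

lemma dec_grandchild: "u @ [i, j] \<in> W \<Longrightarrow> dec (u @ [i, j]) \<noteq> dec u"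
proof -
  assume W: "u @ [i, j] \<in> W"
  then have "u @ [i] \<in> W" "j \<in> {j. (u @ [i]) @ [j] \<in> W}" using snoc_tree_words[of "u @ [i]" j q] by auto
  then have "dec ((u @ [i]) @ [j]) \<in> nbrs (dec (u @ [i])) - parents (u @ [i])"
    using dec_children[of "u @ [i]"] bij_betwE by blast
  then show ?thesis by (simp add: parents_def)
qed

lemma dec_edge: "u \<in> W \<Longrightarrow> v \<in> W \<Longrightarrow> ld u v = 1 \<Longrightarrow> E (dec u) (dec v)"
  using ld_eq_1D[of u v] dec_child_edge E_sym by blast

text \<open>Acyclicity enters here. For distinct words at minimal distance with equal decodings, the
  geodesic between them decodes to a closed walk, whose vertices are otherwise distinct by
  minimality: a cycle.\<close>

lemma dec_inj:
  assumes "u \<in> W" "v \<in> W" "dec u = dec v"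
  shows "u = v"
proof -
  have "\<forall>u\<in>W. \<forall>v\<in>W. ld u v = real n \<longrightarrow> dec u = dec v \<longrightarrow> u = v" for n
  proof (induction n rule: less_induct)
    case (less n)
    show ?case
    proof (intro ballI impI, rule ccontr)
      fix u v assume uv: "u \<in> W" "v \<in> W" "ld u v = real n" "dec u = dec v" "u \<noteq> v"
      obtain y where y: "y 0 = u" "y n = v" "\<forall>i\<le>n. y i \<in> W" and st: "\<forall>i<n. ld (y i) (y (Suc i)) = 1"
        using geodesic_exists[OF uv(1,2) take_tree_words uv(3)] by blast
      have edge: "E (dec (y i)) (dec (y (Suc i)))" if "i < n" for i
        using that y(3) st by (intro dec_edge) auto
      have n0: "n \<noteq> 0" using uv y by (cases n) auto
      have n1: "n \<noteq> 1" using edge[of 0] y(1,2) uv(4) E_irrefl by auto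
      \<comment> \<open>A cycle needs three vertices, so distance 2 is treated separately: siblings
        decode differently, and a grandchild differs from its grandparent.\<close>
      have n2: "n \<noteq> 2"
      proof
        assume n: "n = 2"
        have W: "y 1 \<in> W" using y n by simp
        have gc: False if "y 1 = a @ [i]" "b = y 1 @ [j]" "a \<in> W" "b \<in> W" "dec a = dec b" for a b i j
          using that dec_grandchild[of a i j] by simp
        have "ld u (y 1) = 1" "ld (y 1) v = 1" using st[rule_format, of 0] st[rule_format, of 1] y n
          by (auto simp: numeral_2_eq_2)
        then consider i j where "y 1 = u @ [i]" "v = y 1 @ [j]" | i j where "y 1 = u @ [i]" "y 1 = v @ [j]"
          | i j where "u = y 1 @ [i]" "v = y 1 @ [j]" | i j where "u = y 1 @ [i]" "y 1 = v @ [j]"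
          using ld_eq_1D by metis
        then show False
        proof cases
          case 1
          then show ?thesis using gc uv by metis
        next
          case 2
          then show ?thesis using uv by simp
        next
          case 3
          then show ?thesis using uv dec_child_inj by metis
        next
          case 4
          then show ?thesis using gc uv by metis
        qed
      qed
      \<comment> \<open>The index \<open>n\<close> is left out, since \<open>y n\<close> decodes to
        the same vertex as \<open>y 0\<close>.\<close>
      define p where "p = map (\<lambda>i. dec (y i)) [0..<n]"
      have inj: "dec (y i) \<noteq> dec (y j)" if ij: "i < j" "j < n" for i j
      proof
        assume eq: "dec (y i) = dec (y j)"
        have "ld (y i) (y j) \<le> real (j - i)" using ld_chain[OF st] ij by simp
        then have "nat \<lfloor>ld (y i) (y j)\<rfloor> < n" using ij by linarith
        moreover have "ld (y i) (y j) = real (nat \<lfloor>ld (y i) (y j)\<rfloor>)" by (simp add: ld_nat)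
        ultimately have "y i = y j" using less eq y(3) ij by (meson less_imp_le less_trans)
        moreover have "ld u (y i) \<le> real i" "ld (y j) v \<le> real (n - j)"
          using ld_chain[OF st, of 0 i] ld_chain[OF st, of j n] ij y by auto
        ultimately show False using uv(3) ij ld_tri[of u v "y i"] by auto
      qed
      have "distinct p"
        unfolding p_def distinct_map by (auto simp: inj_on_def) (metis inj linorder_neqE_nat)
      moreover have "set p \<subseteq> V" using y(3) dec_V by (auto simp: p_def)
      moreover have "successively E p"
        unfolding successively_conv_nth p_def using edge by auto
      moreover have "E (last p) (hd p)"
      proof -
        have "last p = dec (y (n - 1))" using n0 by (simp add: p_def last_map)
        moreover have "hd p = dec (y n)" using n0 y uv(4) by (simp add: p_def hd_map)
        ultimately show ?thesis using edge[of "n - 1"] n0 by simp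
      qed
      moreover have "3 \<le> length p" using n0 n1 n2 by (simp add: p_def)
      ultimately have "is_cycle V E p" by (simp add: is_cycle_def)
      then show False using tree by (auto simp: regular_tree_def is_tree_def)
    qed
  qed
  then show ?thesis using assms ld_nat by blast
qed

lemma nbr_word:
  assumes "u \<in> W" "E (dec u) w"
  shows "\<exists>v\<in>W. dec v = w \<and> ld u v = 1"
proof (cases "w \<in> parents u")
  case True
  then obtain v i where "u = v @ [i]" "w = dec v"
    by (cases u rule: rev_cases) (auto simp: parents_def)
  then show ?thesis using assms(1) by (intro bexI[of _ v]) (auto simp: snoc_tree_words)
next
  case False
  have "w \<in> nbrs (dec u)" using assms(2) E_in by (auto simp: nbrs_def)
  then have "w \<in> (\<lambda>i. dec (u @ [i])) ` {i. u @ [i] \<in> W}"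
    using False dec_children[OF assms(1)] by (auto simp: bij_betw_def)
  then show ?thesis by auto
qed

text \<open>As \<open>dec\<close> is a covering, walks lift step by step. With connectedness this
  gives surjectivity, and it bounds path distances from below.\<close>

lemma walk_word:
  assumes "successively E p" "p \<noteq> []" "hd p = dec u" "u \<in> W"
  shows "\<exists>v\<in>W. dec v = last p \<and> ld u v \<le> real (length p) - 1"
  using assms
proof (induction p arbitrary: u)
  case (Cons a p)
  show ?case
  proof (cases "p = []")
    case True
    then show ?thesis using Cons by (intro bexI[of _ u]) auto
  next
    case False
    then have "E (dec u) (hd p)" "successively E p" using Cons by (auto simp: successively_Cons)
    then obtain w where w: "w \<in> W" "dec w = hd p" "ld u w = 1" using nbr_word Cons by metis
    then obtain v where "v \<in> W" "dec v = last p" "ld w v \<le> real (length p) - 1"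
      using Cons(1)[of w] False \<open>successively E p\<close> by auto
    then show ?thesis using w(3) False ld_tri[of u v w] by (intro bexI[of _ v]) auto
  qed
qed simp

lemma dec_bij: "bij_betw dec W V"
proof -
  have "v \<in> dec ` W" if v: "v \<in> V" for v
  proof -
    obtain p where p: "is_walk V E root v p"
      using tree v root unfolding regular_tree_def is_tree_def connected_graph_def by blast
    then have "\<exists>w\<in>W. dec w = last p \<and> ld [] w \<le> real (length p) - 1"
      using Nil_tree_words by (intro walk_word) (auto simp: is_walk_def dec_Nil)
    then show ?thesis using p by (auto simp: is_walk_def)
  qed
  then show ?thesis using dec_inj dec_V by (auto simp: bij_betw_def inj_on_def)
qed

text \<open>A geodesic of words decodes to a walk of the required length; conversely, a walk lifts
  to words, and injectivity identifies the endpoint of the lift with \<open>v\<close>.\<close>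

lemma path_dist_dec:
  assumes "u \<in> W" "v \<in> W"
  shows "path_dist V E (dec u) (dec v) = ld u v"
proof -
  define n where "n = length u + length v - 2 * lcp u v"
  have n: "ld u v = real n" by (simp add: n_def ld_nat)
  obtain y where y: "y 0 = u" "y n = v" "\<forall>i\<le>n. y i \<in> W" and st: "\<forall>i<n. ld (y i) (y (Suc i)) = 1"
    using geodesic_exists[OF assms take_tree_words n] by blast
  define p where "p = map (\<lambda>i. dec (y i)) [0..<Suc n]"
  have "successively E p"
    unfolding successively_conv_nth p_def
  proof (intro allI impI)
    fix i assume "Suc i < length (map (\<lambda>i. dec (y i)) [0..<Suc n])"
    then have "i < n" by simp
    then show "E (map (\<lambda>i. dec (y i)) [0..<Suc n] ! i) (map (\<lambda>i. dec (y i)) [0..<Suc n] ! Suc i)"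
      using y(3) st dec_edge[of "y i" "y (Suc i)"] by (simp add: nth_append del: upt_Suc)
  qed
  moreover have "hd p = dec u" "last p = dec v"
    using y by (simp_all add: p_def hd_map last_map del: upt_Suc)
  moreover have "set p \<subseteq> V" using y(3) dec_V by (auto simp: p_def)
  moreover have "p \<noteq> []" "length p = Suc n" by (simp_all add: p_def)
  ultimately have ex: "\<exists>p. is_walk V E (dec u) (dec v) p \<and> length p = Suc n"
    unfolding is_walk_def by blast
  have "n \<le> m" if walk: "\<exists>p. is_walk V E (dec u) (dec v) p \<and> length p = Suc m" for m
  proof -
    obtain p where p: "is_walk V E (dec u) (dec v) p" "length p = Suc m" using walk by blast
    then obtain w where w: "w \<in> W" "dec w = dec v" "ld u w \<le> real (length p) - 1"
      using walk_word[of p u] assms(1) by (auto simp: is_walk_def)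
    then have "w = v" using dec_inj assms(2) by blast
    then show ?thesis using w p n by simp
  qed
  then have "(LEAST n. \<exists>p. is_walk V E (dec u) (dec v) p \<and> length p = Suc n) = n"
    using ex by (intro Least_equality)
  then show ?thesis by (simp add: path_dist_def n)
qed

end

theorem corollary6p9:
  fixes q :: nat
    and V :: "'v set"
    and E :: "'v \<Rightarrow> 'v \<Rightarrow> bool"
  assumes "q \<ge> 2"
    and "regular_tree q V E"
  shows "uniformly_simple 5 (QI V (path_dist V E)) \<and>
         uniformly_simple 5 (AI V (path_dist V E))"
proof -
  have "V \<noteq> {}" using assms(2) by (auto simp: regular_tree_def is_tree_def connected_graph_def)
  then obtain root where "root \<in> V" by blast
  then interpret rooted_regular_tree q V E root using assms(2) by unfold_locales
  define code where "code = inv_into W dec"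
  have code_bij: "bij_betw code V W" unfolding code_def by (rule bij_betw_inv_into[OF dec_bij])
  have code: "path_dist V E u v = ld (code u) (code v)" if "u \<in> V" "v \<in> V" for u v
  proof -
    have "dec (code u) = u" "dec (code v) = v" "code u \<in> W" "code v \<in> W"
      using that dec_bij code_bij bij_betw_inv_into_right[OF dec_bij] bij_betwE[OF code_bij]
      by (auto simp: code_def)
    then show ?thesis using path_dist_dec by metis
  qed
  have metric: "coarse_space L V (path_dist V E)" if "scale_set L" for L
  proof -
    interpret scale_set L by (rule that)
    show ?thesis by unfold_locales (auto simp: code ld_sym ld_tri)
  qed
  have simple: "uniformly_simple 5 (maps_mod_bounded V (path_dist V E) (coarse_space.S L V (path_dist V E)))"
    if "scale_set L" for L
  proof -
    interpret scale_set L by (rule that)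
    interpret words L q using assms(1) by unfold_locales
    obtain f where f: "bij_betw f W X" "\<And>x y. \<bar>ld (f x) (f y) - ld x y\<bar> \<le> 6"
      using tree_words_almost_isometry by blast
    show ?thesis
    proof (rule uniformly_simple_transfer)
      show "coarse_space L V (path_dist V E)" by (rule metric[OF that])
      show "bij_betw (f \<circ> code) V X" by (rule bij_betw_trans[OF code_bij f(1)])
      show "\<bar>ld ((f \<circ> code) u) ((f \<circ> code) v) - path_dist V E u v\<bar> \<le> 6" if "u \<in> V" "v \<in> V" for u v
        using f(2) code[OF that] by simp
    qed
  qed
  have mult: "1 \<le> l * m" if "1 \<le> l" "1 \<le> m" for l m :: real
    using that mult_mono[of 1 l 1 m] by simp
  \<comment> \<open>The half-line yields all quasi-isometries, the singleton the
    almost-isometries.\<close>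
  have L: "scale_set {1..}" "scale_set {1}" by unfold_locales (auto intro: mult)
  have "quasi_isometries V (path_dist V E) = coarse_space.S {1..} V (path_dist V E)"
    by (auto simp: quasi_isometries_def coarse_space.S_def[OF metric[OF L(1)]])
  moreover have "almost_isometries V (path_dist V E) = coarse_space.S {1} V (path_dist V E)"
    by (auto simp: almost_isometries_def coarse_space.S_def[OF metric[OF L(2)]])
  ultimately show ?thesis using simple[OF L(1)] simple[OF L(2)] by (simp add: QI_def AI_def)
qed

end
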